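(* There is a constant $C>0$, independent of $f$ and $K$, such that the following holds. Let $f\in H^1(-1,1)$ be complex-valued with compact support in $(-1,1)$, let $K>1$, and let $u$ be the associated wave field defined in the context. Set $$\epsilon^2=\int_0^K \omega^2\big(|u(1,\omega)|^2+|u(-1,\omega)|^2\big)\,d\omega ,$$ assume $0<\epsilon<1$, and put $E=-\ln\epsilon$ and $M=\max\{\|f\|_{H^1(-1,1)}^2,\,1\}$. Then $$\|f\|_{L^2(-1,1)}^2\le C\Big(\epsilon^2+\frac{M^2}{K^{2/3}E^{1/4}+1}\Big).$$
   Context: For a complex-valued $f\in L^2(-1,1)$ with compact support in $(-1,1)$ and a frequency $\omega>0$, the wave field is $$u(x,\omega)=\int_{-1}^1 \frac{i\,e^{i\omega|x-y|}}{2\omega}\,f(y)\,dy,\qquad x\in[-1,1].$$ This is the solution of the one-dimensional Helmholtz equation $u''+\omega^2u=f$ on $(-1,1)$ with the outgoing conditions $u'(-1,\omega)+i\omega u(-1,\omega)=0$ and $u'(1,\omega)-i\omega u(1,\omega)=0$. The data used are the boundary values $u(\pm1,\omega)$ for $\omega\in(0,K)$. *)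

theory Defs
  imports "HOL-Analysis.Analysis"
begin

definition compact_supp_in :: "(real \<Rightarrow> 'a::zero) \<Rightarrow> bool" where
  "compact_supp_in h \<longleftrightarrow> (\<exists>a<1. \<forall>x. a < \<bar>x\<bar> \<longrightarrow> h x = 0)"

definition test_fun :: "(real \<Rightarrow> real) \<Rightarrow> bool" where
  "test_fun \<phi> \<longleftrightarrow> (\<forall>n x. ((deriv ^^ n) \<phi>) differentiable (at x)) \<and> compact_supp_in \<phi>"

definition L2_on :: "(real \<Rightarrow> complex) \<Rightarrow> bool" where
  "L2_on h \<longleftrightarrow> set_borel_measurable lborel {-1..1} h \<and>
     set_integrable lborel {-1..1} (\<lambda>x. (cmod (h x))\<^sup>2)"

definition L2_norm_sq :: "(real \<Rightarrow> complex) \<Rightarrow> real" where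
  "L2_norm_sq h = (LINT x:{-1..1}|lborel. (cmod (h x))\<^sup>2)"

definition weak_deriv :: "(real \<Rightarrow> complex) \<Rightarrow> (real \<Rightarrow> complex) \<Rightarrow> bool" where
  "weak_deriv h g \<longleftrightarrow> L2_on h \<and> L2_on g \<and>
     (\<forall>\<phi>. test_fun \<phi> \<longrightarrow>
        (LINT x:{-1..1}|lborel. h x * complex_of_real (deriv \<phi> x)) =
        - (LINT x:{-1..1}|lborel. g x * complex_of_real (\<phi> x)))"

definition H1_norm_sq :: "(real \<Rightarrow> complex) \<Rightarrow> (real \<Rightarrow> complex) \<Rightarrow> real" where
  "H1_norm_sq h g = L2_norm_sq h + L2_norm_sq g"

definition wave_field :: "(real \<Rightarrow> complex) \<Rightarrow> real \<Rightarrow> real \<Rightarrow> complex" where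
  "wave_field f x \<omega> = (LINT y:{-1..1}|lborel.
      (\<i> * exp (\<i> * complex_of_real (\<omega> * \<bar>x - y\<bar>)) / complex_of_real (2 * \<omega>)) * f y)"

definition boundary_data_sq :: "(real \<Rightarrow> complex) \<Rightarrow> real \<Rightarrow> real" where
  "boundary_data_sq f K = (LINT \<omega>:{0..K}|lborel.
      \<omega>\<^sup>2 * ((cmod (wave_field f 1 \<omega>))\<^sup>2 + (cmod (wave_field f (-1) \<omega>))\<^sup>2))"

end

theory Submission
  imports Defs "HOL-Probability.Probability" "HOL-Computational_Algebra.Polynomial" "HOL-Real_Asymp.Real_Asymp"
begin

text \<open>
Let $F$ be the Fourier transform of $f$. On the boundary $|u(\pm 1,\omega)| = |F(\pm\omega)|/(2\omega)$,
so $4\epsilon^2 = \int_{-K}^{K}|F|^2$. Averaging $|F(z/\sigma)|^2$ over a standard normal $z$ gives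
$\int e^{-t^2/2\sigma^2} c(t)\,dt$, where $c$ is the autocorrelation of $f$, and polarization together with
$\|f(\cdot+t)-f\|^2 \le t^2\|f'\|^2$ yields $\mathrm{Re}\, c(t) \ge \|f\|^2 - t^2\|f'\|^2/2$. With
$\sigma = s^{-2/3}$ and the sixth moment of the normal distribution for the tail, this bounds $\|f\|^2$ by
$\int_{-s}^{s}|F|^2 + O(M^2 s^{-4/3})$ without Plancherel's theorem.

Take $s = \max(K, E^{3/8})$, so that $K^{2/3}E^{1/4} \le s^{4/3}$. If $s = K$, the low frequencies are the
data. Otherwise $\epsilon = \exp(-s^{8/3})$ is so small that $F$, being Lipschitz, is tiny on $[0,1]$. A Taylor
polynomial of $F$ of degree $N \approx s^{4/3}$, interpolated at the nodes $j/N$, carries this smallness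
to $[-s,s]$ at the cost of a factor $(4es)^N$.
\<close>

section \<open>Smooth cutoff functions\<close>

text \<open>The exponents come from the target K^(2/3) E^(1/4): since E^(1/4) is the 2/3-power of
  E^(3/8), the quantities K and E^(3/8) enter symmetrically, and an error s^(-4/3) in their maximum
  s is enough. The interpolation degree N has a window: N must be well above s, so that N! beats the
  growth factor in the Taylor remainder, and N ln s must be well below s^(8/3), so that the data
  beat it. N about s^(4/3) lies inside. The hypothesis on f' speaks only of smooth test functions
  supported inside (-1,1), while the estimates need translates of f. The bridge is that f agrees
  almost everywhere with a primitive of a square-integrable function vanishing outside [-1,1]; this
  calls for explicit smooth cutoffs and smooth approximations of indicators of rays. The primitive
  is bounded with compact support, which gives the Fubini exchanges elementary majorants. A Gaussian
  weight suits the averaging because it and its transform are both nonnegative, so that an upper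
  bound for |F|^2 and a lower bound for Re c can be inserted into one identity.\<close>

definition smooth_fun :: "(real \<Rightarrow> real) \<Rightarrow> bool" where
  "smooth_fun f \<longleftrightarrow> (\<forall>n x. ((deriv ^^ n) f) differentiable (at x))"

text \<open>Membership in \<open>S\<close> passes along iterated derivatives, so no formula for an
  n-th derivative ever appears; a smoothness proof only has to exhibit a family closed under
  differentiation.\<close>

lemma smooth_fun_coinduct:
  assumes "f \<in> S"
    and "\<And>f. f \<in> S \<Longrightarrow> \<exists>g\<in>S. \<forall>x. (f has_real_derivative g x) (at x)"
  shows "smooth_fun f"
proof -
  have step: "deriv f \<in> S \<and> (\<forall>x. f differentiable (at x))" if f: "f \<in> S" for f
  proof -
    obtain g where g: "g \<in> S" "\<And>x. (f has_real_derivative g x) (at x)"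
      using assms(2)[OF f] by blast
    have "deriv f = g" using g(2) by (auto intro: DERIV_imp_deriv)
    then show ?thesis using g by (auto simp: real_differentiable_def)
  qed
  have "(deriv ^^ n) f \<in> S" for n
    using assms(1) step by (induction n) auto
  then show ?thesis unfolding smooth_fun_def using step by blast
qed

lemma smooth_fun_DERIV: "smooth_fun f \<Longrightarrow> (f has_real_derivative deriv f x) (at x)"
proof -
  assume "smooth_fun f"
  then have "(deriv ^^ 0) f differentiable (at x)" unfolding smooth_fun_def by blast
  then show ?thesis by (simp add: DERIV_deriv_iff_real_differentiable)
qed

lemma smooth_fun_deriv: "smooth_fun f \<Longrightarrow> smooth_fun (deriv f)"
  unfolding smooth_fun_def by (metis comp_apply funpow_Suc_right)

lemma smooth_fun_continuous_on: "smooth_fun f \<Longrightarrow> continuous_on A f"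
  by (meson DERIV_isCont continuous_at_imp_continuous_on smooth_fun_DERIV)

lemma smooth_fun_antideriv:
  assumes "\<And>x. (F has_real_derivative f x) (at x)" "smooth_fun f"
  shows "smooth_fun F"
proof (rule smooth_fun_coinduct[where S = "insert F {f. smooth_fun f}"])
  show "\<exists>g\<in>insert F {f. smooth_fun f}. \<forall>x. (h has_real_derivative g x) (at x)"
    if "h \<in> insert F {f. smooth_fun f}" for h
    using that assms smooth_fun_DERIV smooth_fun_deriv by blast
qed simp

lemma smooth_fun_const: "smooth_fun (\<lambda>_. c)"
proof (rule smooth_fun_coinduct[where S = "{\<lambda>_. c, \<lambda>_. 0}"])
  show "\<exists>g\<in>{\<lambda>_. c, \<lambda>_. 0}. \<forall>x. (h has_real_derivative g x) (at x)" if "h \<in> {\<lambda>_. c, \<lambda>_. 0}" for h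
    using that by auto
qed simp

text \<open>The Leibniz rule turns a product into a sum of two products, so products alone are not
  closed under differentiation. This closure serves as the coinduction family.\<close>

inductive_set product_sums :: "(real \<Rightarrow> real) set" where
  prod: "smooth_fun f \<Longrightarrow> smooth_fun g \<Longrightarrow> (\<lambda>x. f x * g x) \<in> product_sums"
| sum: "u \<in> product_sums \<Longrightarrow> v \<in> product_sums \<Longrightarrow> (\<lambda>x. u x + v x) \<in> product_sums"

lemma smooth_fun_mult:
  assumes "smooth_fun f" "smooth_fun g"
  shows "smooth_fun (\<lambda>x. f x * g x)"
proof (rule smooth_fun_coinduct[where S = product_sums])
  show "\<exists>g\<in>product_sums. \<forall>x. (h has_real_derivative g x) (at x)" if "h \<in> product_sums" for h
    using that
  proof induction
    case (prod f g)
    have "(\<lambda>x. deriv f x * g x + f x * deriv g x) \<in> product_sums"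
      using prod by (intro product_sums.intros smooth_fun_deriv)
    moreover have "((\<lambda>x. f x * g x) has_real_derivative (deriv f x * g x + f x * deriv g x)) (at x)" for x
      using DERIV_mult'[OF smooth_fun_DERIV[OF prod(1)] smooth_fun_DERIV[OF prod(2)]]
      by (simp add: add.commute)
    ultimately show ?case by (intro bexI) auto
  next
    case (sum u v)
    then obtain u' v' where "u' \<in> product_sums" "v' \<in> product_sums"
      "\<And>x. (u has_real_derivative u' x) (at x)" "\<And>x. (v has_real_derivative v' x) (at x)"
      by blast
    then show ?case
      by (intro bexI[of _ "\<lambda>x. u' x + v' x"] allI DERIV_add product_sums.sum)
  qed
qed (use assms in \<open>rule product_sums.prod\<close>)

lemma smooth_fun_affine:
  assumes "smooth_fun f"
  shows "smooth_fun (\<lambda>x. f (a * x + b))"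
\<comment> \<open>Each differentiation emits a factor \<open>a\<close> by the chain rule; the free
  constant \<open>c\<close> absorbs it.\<close>
proof (rule smooth_fun_coinduct[where S = "{\<lambda>x. c * g (a * x + b) | c g. smooth_fun g}"])
  show "(\<lambda>x. f (a * x + b)) \<in> {\<lambda>x. c * g (a * x + b) | c g. smooth_fun g}"
    using assms by (auto intro!: exI[of _ 1] exI[of _ f])
  fix h assume "h \<in> {\<lambda>x. c * g (a * x + b) | c g. smooth_fun g}"
  then obtain c g where h: "h = (\<lambda>x. c * g (a * x + b))" and g: "smooth_fun g" by blast
  have "(h has_real_derivative (c * a) * deriv g (a * x + b)) (at x)" for x
    unfolding h
    by (rule derivative_eq_intros DERIV_chain2[OF smooth_fun_DERIV[OF g]] refl | simp)+
  then show "\<exists>g\<in>{\<lambda>x. c * g (a * x + b) | c g. smooth_fun g}. \<forall>x. (h has_real_derivative g x) (at x)"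
    using smooth_fun_deriv[OF g]
    by (intro bexI[of _ "\<lambda>x. (c * a) * deriv g (a * x + b)"]) blast+
qed

section \<open>Functions flat at the origin\<close>

lemma poly_times_exp_minus_tendsto_0:
  fixes p :: "real poly"
  shows "((\<lambda>t. poly p t * exp (- t)) \<longlongrightarrow> 0) at_top"
proof -
  \<comment> \<open>The extra power makes the induction work: splitting off the constant coefficient
    leaves \<open>t * poly p t\<close>, which the induction hypothesis covers at
    \<open>Suc k\<close>.\<close>
  have "((\<lambda>t. t ^ k * poly p t * exp (- t)) \<longlongrightarrow> 0) at_top" for k
  proof (induction p arbitrary: k)
    case (pCons a p)
    have "((\<lambda>t. a * (t ^ k / exp t) + t ^ Suc k * poly p t * exp (- t)) \<longlongrightarrow> a * 0 + 0) at_top"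
      by (intro tendsto_intros tendsto_power_div_exp_0 pCons.IH)
    then show ?case by (simp add: exp_minus field_simps)
  qed simp
  from this[of 0] show ?thesis by simp
qed

definition flat_exp :: "real poly \<Rightarrow> real \<Rightarrow> real" where
  "flat_exp p x = (if 0 < x then poly p (1 / x) * exp (- (1 / x)) else 0)"

text \<open>Put y = 1/x, so dy/dx = -y^2; then p(y) exp(-y) has derivative y^2 (p(y) - p'(y))
  exp(-y), and \<open>[:0, 0, 1:]\<close> is the factor y^2. At the origin the right difference
  quotient is again a polynomial in 1/h, namely \<open>pCons 0 p\<close>, times exp(-1/h), and tends
  to 0. Hence \<open>range flat_exp\<close> is closed under differentiation.\<close>

lemma flat_exp_DERIV:
  "(flat_exp p has_real_derivative flat_exp ([:0, 0, 1:] * (p - pderiv p)) x) (at x)"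
proof -
  consider "x < 0" | "x = 0" | "x > 0" by linarith
  then show ?thesis
  proof cases
    case 1
    then have "((\<lambda>_. 0) has_real_derivative 0) (at x)" "\<forall>\<^sub>F y in nhds x. flat_exp p y = 0"
      using eventually_nhds_in_open[of "{..<0}" x] by (auto simp: flat_exp_def elim: eventually_mono)
    then show ?thesis using 1 by (subst DERIV_cong_ev[OF refl _ refl]) (auto simp: flat_exp_def)
  next
    case 3
    have "((\<lambda>x. poly p (1 / x) * exp (- (1 / x))) has_real_derivative
        flat_exp ([:0, 0, 1:] * (p - pderiv p)) x) (at x)"
      using 3
      by (auto intro!: derivative_eq_intros simp: flat_exp_def field_simps power2_eq_square)
    moreover have "\<forall>\<^sub>F y in nhds x. flat_exp p y = poly p (1 / y) * exp (- (1 / y))"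
      using eventually_nhds_in_open[of "{0<..}" x] 3 by (auto simp: flat_exp_def elim: eventually_mono)
    ultimately show ?thesis by (subst DERIV_cong_ev[OF refl _ refl]) auto
  next
    case 2
    have "((\<lambda>h. flat_exp p h / h) \<longlongrightarrow> 0) (at_right 0)"
    proof -
      have "((\<lambda>h. poly (pCons 0 p) (inverse h) * exp (- inverse h)) \<longlongrightarrow> 0) (at_right 0)"
        by (rule filterlim_compose[OF poly_times_exp_minus_tendsto_0 filterlim_inverse_at_top_right])
      moreover have "\<forall>\<^sub>F h in at_right (0::real). poly (pCons 0 p) (inverse h) * exp (- inverse h) = flat_exp p h / h"
        using eventually_at_right_less[of "0::real"]
        by eventually_elim (simp add: flat_exp_def field_simps)
      ultimately show ?thesis by (rule Lim_transform_eventually)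
    qed
    moreover have "((\<lambda>h. flat_exp p h / h) \<longlongrightarrow> 0) (at_left 0)"
    proof (rule Lim_transform_eventually[OF tendsto_const])
      show "\<forall>\<^sub>F h in at_left 0. 0 = flat_exp p h / h"
        by (auto simp: flat_exp_def eventually_at_left_field intro!: exI[of _ "-1"])
    qed
    ultimately have "((\<lambda>h. flat_exp p h / h) \<longlongrightarrow> 0) (at 0)"
      by (simp add: filterlim_split_at)
    then show ?thesis using 2 by (simp add: DERIV_def flat_exp_def)
  qed
qed

lemma smooth_fun_flat_exp: "smooth_fun (flat_exp p)"
  by (rule smooth_fun_coinduct[where S = "range flat_exp"]) (auto intro: flat_exp_DERIV)

section \<open>Smooth steps and cutoffs\<close>

lemma smooth_antiderivative_exists:
  assumes "smooth_fun f"
  obtains F where "smooth_fun F" "F a = 0" "\<And>x. (F has_real_derivative f x) (at x)"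
proof -
  have "isCont f x" for x
    using assms by (meson DERIV_isCont smooth_fun_DERIV)
  then obtain F where "\<And>x. (F has_vector_derivative f x) (at x)"
    using einterval_antiderivative[of "-\<infinity>" \<infinity> f] by auto
  then have "((\<lambda>x. F x - F a) has_real_derivative f x) (at x)" for x
    by (auto intro!: derivative_eq_intros simp: has_real_derivative_iff_has_vector_derivative)
  then show ?thesis using that[of "\<lambda>x. F x - F a"] smooth_fun_antideriv[OF _ assms] by force
qed

text \<open>The step is the primitive of a bump \<beta> living on (0,1), divided by its total mass.
  That mass is positive by the mean value theorem, as \<beta> > 0 inside the interval; monotonicity
  confines the values to [0,1].\<close>

lemma smooth_step_exists:
  obtains B :: "real \<Rightarrow> real" where "smooth_fun B" "\<And>x. x \<le> 0 \<Longrightarrow> B x = 0" "\<And>x. 1 \<le> x \<Longrightarrow> B x = 1"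
    "\<And>x. 0 \<le> B x" "\<And>x. B x \<le> 1"
proof -
  define \<beta> where "\<beta> x = flat_exp 1 x * flat_exp 1 ((-1) * x + 1)" for x
  have smooth: "smooth_fun \<beta>"
    unfolding \<beta>_def[abs_def] by (intro smooth_fun_mult smooth_fun_affine smooth_fun_flat_exp)
  have \<beta>0: "\<beta> x = 0" if "x \<le> 0 \<or> 1 \<le> x" for x
    using that by (auto simp: \<beta>_def flat_exp_def)
  have \<beta>pos: "0 < \<beta> x" if "0 < x" "x < 1" for x
    using that by (auto simp: \<beta>_def flat_exp_def)
  have \<beta>nonneg: "0 \<le> \<beta> x" for x
    using \<beta>0[of x] \<beta>pos[of x] by (cases "0 < x \<and> x < 1") auto
  obtain F where F: "smooth_fun F" "F 0 = 0" "\<And>x. (F has_real_derivative \<beta> x) (at x)"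
    using smooth_antiderivative_exists[OF smooth] by metis
  have mono: "F x \<le> F y" if "x \<le> y" for x y
    by (rule DERIV_nonneg_imp_nondecreasing[OF that]) (use F(3) \<beta>nonneg in blast)
  have F0: "F x = 0" if "x \<le> 0" for x
  proof (cases "x < 0")
    case True
    then obtain z where "x < z" "z < 0" "F 0 - F x = (0 - x) * \<beta> z"
      using MVT2[of x 0 F \<beta>] F(3) by auto
    then show ?thesis using \<beta>0[of z] F(2) by auto
  qed (use that F(2) in auto)
  have F1: "F x = F 1" if "1 \<le> x" for x
  proof (cases "1 < x")
    case True
    then obtain z where "1 < z" "z < x" "F x - F 1 = (x - 1) * \<beta> z"
      using MVT2[of 1 x F \<beta>] F(3) by auto
    then show ?thesis using \<beta>0[of z] F(2) by auto
  qed (use that in auto)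
  obtain z where z: "0 < z" "z < 1" "F 1 - F 0 = (1 - 0) * \<beta> z"
    using MVT2[of 0 1 F \<beta>] F(3) by auto
  then have pos: "0 < F 1" using \<beta>pos[of z] F(2) by auto
  have "smooth_fun (\<lambda>x. F x * (1 / F 1))"
    by (intro smooth_fun_mult F smooth_fun_const)
  moreover have "0 \<le> F x" for x
    using mono[of 0 x] F0[of x] F(2) by (cases "0 \<le> x") auto
  moreover have "F x \<le> F 1" for x
    using mono[of x 1] F1[of x] by (cases "x \<le> 1") auto
  moreover have "F x * (1 / F 1) = 1" if "1 \<le> x" for x
    unfolding F1[OF that] using pos by simp
  ultimately show ?thesis
    using pos by (intro that[of "\<lambda>x. F x * (1 / F 1)"]) (simp_all add: F0)
qed

lemma smooth_cutoff_exists: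
  fixes a b :: real
  assumes "a < b"
  obtains \<kappa> where "smooth_fun \<kappa>" "\<And>x. \<bar>x\<bar> \<le> a \<Longrightarrow> \<kappa> x = 1" "\<And>x. b \<le> \<bar>x\<bar> \<Longrightarrow> \<kappa> x = 0"
    "\<And>x. 0 \<le> \<kappa> x" "\<And>x. \<kappa> x \<le> 1"
proof -
  obtain B :: "real \<Rightarrow> real" where B: "smooth_fun B" "\<And>x. x \<le> 0 \<Longrightarrow> B x = 0" "\<And>x. 1 \<le> x \<Longrightarrow> B x = 1"
    "\<And>x. 0 \<le> B x" "\<And>x. B x \<le> 1"
    using smooth_step_exists by blast
  define k where "k = 1 / (b - a)"
  have k: "0 < k" "k * (b - a) = 1" using assms by (auto simp: k_def)
  \<comment> \<open>A step rising on [-b,-a] times a step falling on [a,b]; the slope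
    \<open>k\<close> stretches the transition length b - a to 1.\<close>
  define \<kappa> where "\<kappa> x = B (k * x + k * b) * B ((- k) * x + k * b)" for x
  have "smooth_fun \<kappa>"
    unfolding \<kappa>_def[abs_def] by (intro smooth_fun_mult smooth_fun_affine B)
  moreover have "\<kappa> x = 1" if "\<bar>x\<bar> \<le> a" for x
  proof -
    have "k * (b - a) \<le> k * (b + x)" "k * (b - a) \<le> k * (b - x)"
      using that k(1) by (auto intro!: mult_left_mono)
    then show ?thesis using k B(3) by (simp add: \<kappa>_def algebra_simps)
  qed
  moreover have "\<kappa> x = 0" if "b \<le> \<bar>x\<bar>" for x
  proof -
    have "k * (b + x) \<le> 0 \<or> k * (b - x) \<le> 0"
      using that k(1) by (auto simp: mult_le_0_iff abs_if split: if_splits)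
    then show ?thesis using B(2) by (auto simp: \<kappa>_def algebra_simps)
  qed
  ultimately show ?thesis
    using B(4,5) by (intro that[of \<kappa>]) (simp_all add: \<kappa>_def mult_le_one)
qed

section \<open>Primitives of weak derivatives\<close>

text \<open>Product majorants of this shape justify the Fubini exchanges of Bochner integrals
  below.\<close>

lemma integrable_product_lborel:
  fixes u v :: "real \<Rightarrow> real"
  assumes "integrable lborel u" "integrable lborel v"
  shows "integrable (lborel \<Otimes>\<^sub>M lborel) (\<lambda>(x, y). u x * v y)"
proof (rule lborel_pair.Fubini_integrable)
  have [measurable]: "u \<in> borel_measurable lborel" "v \<in> borel_measurable lborel"
    using assms by auto
  show "(\<lambda>(x, y). u x * v y) \<in> borel_measurable (lborel \<Otimes>\<^sub>M lborel)" by measurable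
  show "integrable lborel (\<lambda>x. LINT y|lborel. norm (case (x, y) of (x, y) \<Rightarrow> u x * v y))"
    using assms by (simp add: abs_mult)
  show "AE x in lborel. integrable lborel (\<lambda>y. case (x, y) of (x, y) \<Rightarrow> u x * v y)"
    using assms by simp
qed

text \<open>Open rays are an intersection-stable generator of the Borel sets, and the sets over
  which \<open>d\<close> integrates to 0 are closed under complements and countable disjoint unions.
  So all Borel sets have integral 0, which forces the density to vanish almost everywhere.\<close>

lemma AE_zero_if_integrals_greaterThan_zero:
  fixes d :: "real \<Rightarrow> complex"
  assumes d: "integrable lborel d"
    and zero: "\<And>c. (LINT x:{c<..}|lborel. d x) = 0"
  shows "AE x in lborel. d x = 0"
proof (rule sigma_finite_measure.density_zero[OF sigma_finite_lborel d])
  fix A :: "real set"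
  assume "A \<in> sets lborel"
  then have A: "A \<in> sigma_sets UNIV (range greaterThan)"
    by (simp add: borel_Ioi)
  have int: "set_integrable lborel B d" if "B \<in> sets borel" for B
    using d that by (auto simp: set_integrable_def intro: integrable_mult_indicator)
  have borel: "B \<in> sets borel" if "B \<in> sigma_sets UNIV (range greaterThan)" for B :: "real set"
    using that by (simp add: borel_Ioi)
  \<comment> \<open>The complement case of the induction subtracts from the integral over the whole
    line, obtained here by exhausting it with rays.\<close>
  have total: "(LINT x|lborel. d x) = 0"
  proof -
    have "(\<lambda>n. LINT x:{- real n<..}|lborel. d x) \<longlonglongrightarrow> (LINT x|lborel. d x)"
      unfolding set_lebesgue_integral_def
    proof (rule integral_dominated_convergence[where w = "\<lambda>x. norm (d x)"])
      show "AE x in lborel. (\<lambda>n. indicat_real {- real n<..} x *\<^sub>R d x) \<longlonglongrightarrow> d x"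
      proof (rule AE_I2)
        fix x :: real
        obtain N where N: "- x < real N" using reals_Archimedean2 by blast
        have "\<forall>\<^sub>F n in sequentially. indicat_real {- real n<..} x *\<^sub>R d x = d x"
          using eventually_ge_at_top[of N] by eventually_elim (use N in \<open>auto simp: indicator_def\<close>)
        then show "(\<lambda>n. indicat_real {- real n<..} x *\<^sub>R d x) \<longlonglongrightarrow> d x"
          by (rule tendsto_eventually)
      qed
    qed (use d in \<open>auto simp: indicator_def\<close>)
    then show ?thesis by (simp add: zero LIMSEQ_const_iff)
  qed
  have stable: "Int_stable (range greaterThan :: real set set)"
    unfolding Int_stable_def
  proof safe
    show "{a<..} \<inter> {b<..} \<in> range greaterThan" for a b :: real
      by (intro image_eqI[where x = "max a b"]) auto
  qed
  have "range greaterThan \<subseteq> Pow (UNIV :: real set)" by simp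
  from stable this A show "set_lebesgue_integral lborel A d = 0"
  proof (induction rule: sigma_sets_induct_disjoint)
    fix A :: "real set" assume "A \<in> sigma_sets UNIV (range greaterThan)" and IH: "set_lebesgue_integral lborel A d = 0"
    then have "(LINT x|lborel. d x) = (LINT x:A|lborel. d x) + (LINT x:UNIV - A|lborel. d x)"
      using int[of A] int[of "UNIV - A"] borel[of A]
      by (subst set_integral_Un[symmetric]) (auto simp: set_lebesgue_integral_def)
    then show "set_lebesgue_integral lborel (UNIV - A) d = 0" using IH total by simp
  next
    fix A :: "nat \<Rightarrow> real set"
    assume "disjoint_family A" "range A \<subseteq> sigma_sets UNIV (range greaterThan)"
      and "\<And>i. set_lebesgue_integral lborel (A i) d = 0"
    then show "set_lebesgue_integral lborel (\<Union> (range A)) d = 0"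
      using lebesgue_integral_countable_add[of A lborel d] int[of "\<Union> (range A)"] borel
      by (force simp: disjoint_family_on_def image_subset_iff)
  qed (use zero in \<open>auto simp: set_lebesgue_integral_def\<close>)
qed

lemma L2_on_integrable:
  assumes "L2_on h"
  shows "integrable lborel (\<lambda>x. indicat_real {-1..1} x *\<^sub>R h x)"
proof (rule Bochner_Integration.integrable_bound)
  show "integrable lborel (\<lambda>x. indicat_real {-1..1} x + indicat_real {-1..1} x *\<^sub>R (cmod (h x))\<^sup>2)"
    using assms by (intro Bochner_Integration.integrable_add) (auto simp: L2_on_def set_integrable_def)
  have "t \<le> 1 + t\<^sup>2" for t :: real
  proof -
    have "2 * t \<le> 1 + t\<^sup>2" using zero_le_power2[of "t - 1"] by (simp add: power2_diff)
    then show ?thesis using zero_le_power2[of t] by linarith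
  qed
  then show "AE x in lborel. norm (indicat_real {-1..1} x *\<^sub>R h x)
      \<le> norm (indicat_real {-1..1} x + indicat_real {-1..1} x *\<^sub>R (cmod (h x))\<^sup>2)"
    by (auto simp: indicator_def)
qed (use assms in \<open>simp add: L2_on_def set_borel_measurable_def\<close>)

text \<open>Removes the support condition on test functions. A cutoff \<kappa> equal to 1 near the
  support of \<open>f\<close> makes \<kappa> S admissible for any smooth S; on the left
  \<open>f\<close> does not notice the cutoff, and on the right it is moved onto the derivative,
  giving g = \<kappa> f'. Since 0 \<le> \<kappa> \<le> 1, the norm does not grow.\<close>

lemma weak_deriv_smooth_test:
  assumes wd: "weak_deriv f f'" and supp: "compact_supp_in f"
  obtains g where "g \<in> borel_measurable borel" "\<And>x. 1 < \<bar>x\<bar> \<Longrightarrow> g x = 0" "integrable lborel (\<lambda>x. (cmod (g x))\<^sup>2)"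
    "(LINT x|lborel. (cmod (g x))\<^sup>2) \<le> L2_norm_sq f'" "integrable lborel g"
    "\<And>S. smooth_fun S \<Longrightarrow> (LINT x|lborel. f x * complex_of_real (deriv S x)) = - (LINT x|lborel. g x * complex_of_real (S x))"
proof -
  have L2: "L2_on f'" using wd by (simp add: weak_deriv_def)
  obtain a0 where a0: "a0 < 1" "\<And>x. a0 < \<bar>x\<bar> \<Longrightarrow> f x = 0"
    using supp unfolding compact_supp_in_def by blast
  define a where "a = max a0 0"
  have a: "0 \<le> a" "a < 1" "\<And>x. a < \<bar>x\<bar> \<Longrightarrow> f x = 0" using a0 by (auto simp: a_def)
  \<comment> \<open>The room between \<open>a\<close> and \<open>a1\<close> makes \<kappa> equal to
    1 on a neighbourhood of each point with |x| \<le> a, so that even the derivatives of \<kappa> S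
    and S agree there; b < 1 keeps the support inside (-1,1).\<close>
  define a1 b where "a1 = (2 * a + 1) / 3" and "b = (a + 2) / 3"
  have ab: "a < a1" "a1 < b" "b < 1" using a by (auto simp: a1_def b_def)
  obtain \<kappa> where \<kappa>: "smooth_fun \<kappa>" "\<And>x. \<bar>x\<bar> \<le> a1 \<Longrightarrow> \<kappa> x = 1" "\<And>x. b \<le> \<bar>x\<bar> \<Longrightarrow> \<kappa> x = 0"
    "\<And>x. 0 \<le> \<kappa> x" "\<And>x. \<kappa> x \<le> 1"
    using smooth_cutoff_exists[OF ab(2)] by metis
  define g where "g x = (indicat_real {-1..1} x *\<^sub>R f' x) * complex_of_real (\<kappa> x)" for x
  have \<kappa>m [measurable]: "\<kappa> \<in> borel_measurable borel"
    using \<kappa>(1) by (intro borel_measurable_continuous_onI smooth_fun_continuous_on)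
  have f'm [measurable]: "(\<lambda>x. indicat_real {-1..1} x *\<^sub>R f' x) \<in> borel_measurable borel"
    using L2 by (simp add: L2_on_def set_borel_measurable_def)
  have gm: "g \<in> borel_measurable borel" unfolding g_def[abs_def] by measurable
  have "(cmod (g x))\<^sup>2 \<le> indicat_real {-1..1} x *\<^sub>R (cmod (f' x))\<^sup>2" for x
    using \<kappa>(4,5)[of x] by (auto simp: g_def norm_mult indicator_def power_mult_distrib intro!: mult_left_le power_le_one)
  moreover have i2: "integrable lborel (\<lambda>x. indicat_real {-1..1} x *\<^sub>R (cmod (f' x))\<^sup>2)"
    using L2 by (simp add: L2_on_def set_integrable_def)
  ultimately have g2: "integrable lborel (\<lambda>x. (cmod (g x))\<^sup>2)" "(LINT x|lborel. (cmod (g x))\<^sup>2) \<le> L2_norm_sq f'"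
  proof -
    assume le: "\<And>x. (cmod (g x))\<^sup>2 \<le> indicat_real {-1..1} x *\<^sub>R (cmod (f' x))\<^sup>2"
    show *: "integrable lborel (\<lambda>x. (cmod (g x))\<^sup>2)"
      by (rule Bochner_Integration.integrable_bound[OF i2]) (use gm le in \<open>auto intro!: AE_I2 order_trans[OF _ abs_ge_self]\<close>)
    show "(LINT x|lborel. (cmod (g x))\<^sup>2) \<le> L2_norm_sq f'"
      unfolding L2_norm_sq_def set_lebesgue_integral_def by (rule integral_mono[OF * i2 le])
  qed
  have gi: "integrable lborel g"
    by (rule Bochner_Integration.integrable_bound[OF L2_on_integrable[OF L2]])
       (use gm \<kappa>(4,5) in \<open>auto simp: g_def norm_mult indicator_def intro!: AE_I2 mult_left_le\<close>)
  have test: "(LINT x|lborel. f x * complex_of_real (deriv S x)) = - (LINT x|lborel. g x * complex_of_real (S x))"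
    if S: "smooth_fun S" for S
  proof -
    define \<phi> where "\<phi> x = \<kappa> x * S x" for x
    have "smooth_fun \<phi>" unfolding \<phi>_def[abs_def] by (intro smooth_fun_mult \<kappa> S)
    moreover have "compact_supp_in \<phi>"
      unfolding compact_supp_in_def using ab \<kappa>(3) by (auto simp: \<phi>_def intro!: exI[of _ b])
    ultimately have "(LINT x:{-1..1}|lborel. f x * complex_of_real (deriv \<phi> x)) =
        - (LINT x:{-1..1}|lborel. f' x * complex_of_real (\<phi> x))"
      using wd unfolding weak_deriv_def test_fun_def smooth_fun_def by blast
    moreover have "indicat_real {-1..1} x *\<^sub>R (f x * complex_of_real (deriv \<phi> x)) = f x * complex_of_real (deriv S x)" for x
    proof (cases "\<bar>x\<bar> \<le> a")
      case True
      have "\<forall>\<^sub>F y in nhds x. y \<in> {-a1<..<a1}"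
        using True ab by (intro eventually_nhds_in_open) auto
      then have "\<forall>\<^sub>F y in nhds x. \<phi> y = S y"
        by eventually_elim (auto simp: \<phi>_def \<kappa>(2))
      then have "deriv \<phi> x = deriv S x" by (rule deriv_cong_ev) simp
      then show ?thesis using True a by (auto simp: indicator_def)
    qed (use a in auto)
    moreover have "indicat_real {-1..1} x *\<^sub>R (f' x * complex_of_real (\<phi> x)) = g x * complex_of_real (S x)" for x
      by (simp add: g_def \<phi>_def)
    ultimately show ?thesis by (simp add: set_lebesgue_integral_def)
  qed
  show ?thesis
    by (rule that[OF gm _ g2 gi test]) (auto simp: g_def indicator_def)
qed

section \<open>Primitives and integration by parts\<close>

lemma primitive_measurable:
  fixes g :: "real \<Rightarrow> complex"
  assumes [measurable]: "g \<in> borel_measurable borel"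
  shows "(\<lambda>x. LINT y:{..x}|lborel. g y) \<in> borel_measurable borel"
proof -
  have "(\<lambda>x. LINT y:{..x}|lborel. g y) = (\<lambda>x. LINT y|lborel. (if y \<le> x then g y else 0))"
    unfolding set_lebesgue_integral_def
    by (intro ext Bochner_Integration.integral_cong) (auto simp: indicator_def)
  then show ?thesis by simp
qed

lemma primitive_bound:
  fixes g :: "real \<Rightarrow> complex"
  assumes "integrable lborel g"
  shows "cmod (LINT y:{..x}|lborel. g y) \<le> (LINT y|lborel. cmod (g y))"
proof -
  have "cmod (LINT y:{..x}|lborel. g y) \<le> (LINT y|lborel. norm (indicat_real {..x} y *\<^sub>R g y))"
    unfolding set_lebesgue_integral_def by (rule integral_norm_bound)
  also have "\<dots> \<le> (LINT y|lborel. cmod (g y))"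
    using assms by (intro integral_mono integrable_norm integrable_mult_indicator) (auto simp: indicator_def)
  finally show ?thesis .
qed

lemma primitive_eq_0:
  fixes g :: "real \<Rightarrow> complex"
  assumes "\<And>y. 1 < \<bar>y\<bar> \<Longrightarrow> g y = 0" "(LINT y|lborel. g y) = 0" "1 < \<bar>x\<bar>"
  shows "(LINT y:{..x}|lborel. g y) = 0"
proof (cases "x < -1")
  case True
  then have "indicat_real {..x} y *\<^sub>R g y = 0" for y using assms(1)[of y] by (auto simp: indicator_def)
  then show ?thesis by (simp only: set_lebesgue_integral_def integral_zero)
next
  case False
  then have "indicat_real {..x} y *\<^sub>R g y = g y" for y using assms(3) assms(1)[of y] by (auto simp: indicator_def)
  then show ?thesis using assms(2) by (simp only: set_lebesgue_integral_def)
qed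

text \<open>Integration by parts for a primitive of a merely integrable function: Fubini on the
  triangle y \<le> x. The inner integral of S' from y to 1 is S(1) - S(y), and the boundary term
  S(1) drops out because \<open>g\<close> has integral 0.\<close>

lemma integral_primitive_mult_deriv:
  fixes g :: "real \<Rightarrow> complex" and S :: "real \<Rightarrow> real"
  assumes g: "integrable lborel g" "\<And>x. 1 < \<bar>x\<bar> \<Longrightarrow> g x = 0" "(LINT x|lborel. g x) = 0"
    and S: "smooth_fun S"
  shows "(LINT x|lborel. (LINT y:{..x}|lborel. g y) * complex_of_real (deriv S x)) =
    - (LINT x|lborel. g x * complex_of_real (S x))"
proof -
  have [measurable]: "g \<in> borel_measurable borel" using g(1) by auto
  define S' where "S' = deriv S"
  have DS: "(S has_real_derivative S' x) (at x)" for x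
    unfolding S'_def by (rule smooth_fun_DERIV[OF S])
  have cS': "continuous_on A S'" for A
    unfolding S'_def by (intro smooth_fun_continuous_on smooth_fun_deriv S)
  have [measurable]: "S' \<in> borel_measurable borel" by (intro borel_measurable_continuous_onI cS')
  \<comment> \<open>Cutting x to [-1,1] makes the kernel integrable for any smooth S. It does not
    change the integral, because the primitive vanishes outside that interval.\<close>
  define k where "k x y = (indicat_real {..x} y * indicat_real {-1..1} x * S' x) *\<^sub>R g y" for x y
  have outside: "(LINT y:{..x}|lborel. g y) = 0" if "\<not> (-1 \<le> x \<and> x \<le> 1)" for x
    using that by (intro primitive_eq_0[OF g(2,3)]) auto
  have left: "(LINT y|lborel. k x y) = (LINT y:{..x}|lborel. g y) * complex_of_real (S' x)" for x
  proof -
    have "(LINT y|lborel. k x y) = (LINT y|lborel. (indicat_real {-1..1} x * S' x) *\<^sub>R (indicat_real {..x} y *\<^sub>R g y))"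
      by (intro Bochner_Integration.integral_cong) (auto simp: k_def)
    then show ?thesis
      using outside[of x] by (auto simp: set_lebesgue_integral_def scaleR_conv_of_real indicator_def mult.commute)
  qed
  have right: "(LINT x|lborel. k x y) = (complex_of_real (S 1) - complex_of_real (S y)) * g y" for y
  proof (cases "\<bar>y\<bar> \<le> 1")
    case True
    have "(LINT x|lborel. k x y) = (LINT x|lborel. (indicat_real {y..1} x *\<^sub>R S' x) *\<^sub>R g y)"
      using True by (intro Bochner_Integration.integral_cong) (auto simp: k_def indicator_def)
    also have "\<dots> = (LINT x|lborel. indicat_real {y..1} x *\<^sub>R S' x) *\<^sub>R g y"
      using borel_integrable_compact[OF compact_Icc cS', of y 1] by (intro integral_scaleR_left) auto
    also have "(LINT x|lborel. indicat_real {y..1} x *\<^sub>R S' x) = S 1 - S y"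
      using True DS cS'
      by (intro integral_FTC_atLeastAtMost)
        (auto simp: has_real_derivative_iff_has_vector_derivative[symmetric] intro: DERIV_subset)
    finally show ?thesis by (simp add: scaleR_conv_of_real)
  qed (use g(2) in \<open>auto simp: k_def\<close>)
  obtain C where C: "\<And>x. x \<in> {-1..1} \<Longrightarrow> \<bar>S' x\<bar> \<le> C"
    using continuous_on_compact_bound[OF compact_Icc cS', of "-1" 1] by (metis real_norm_def)
  have kint: "integrable (lborel \<Otimes>\<^sub>M lborel) (\<lambda>(x, y). k x y)"
  proof (rule Bochner_Integration.integrable_bound)
    show "integrable (lborel \<Otimes>\<^sub>M lborel) (\<lambda>(x::real, y). (C * indicat_real {-1..1} x) * norm (g y))"
      by (rule integrable_product_lborel) (use g(1) in auto)
    show "(\<lambda>(x, y). k x y) \<in> borel_measurable (lborel \<Otimes>\<^sub>M lborel)"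
    proof -
      have "(\<lambda>(x, y). k x y) = (\<lambda>p. ((if snd p \<le> fst p then 1 else 0) * indicat_real {-1..1} (fst p) * S' (fst p)) *\<^sub>R g (snd p))"
        by (auto simp: k_def indicator_def)
      then show ?thesis by simp
    qed
    show "AE p in lborel \<Otimes>\<^sub>M lborel. norm (case p of (x, y) \<Rightarrow> k x y)
        \<le> norm (case p of (x::real, y) \<Rightarrow> (C * indicat_real {-1..1} x) * norm (g y))"
      using C by (force simp: k_def indicator_def abs_mult intro!: AE_I2 mult_right_mono)
  qed
  have gS: "integrable lborel (\<lambda>x. complex_of_real (S x) * g x)"
  proof -
    obtain D where D: "\<And>x. x \<in> {-1..1} \<Longrightarrow> \<bar>S x\<bar> \<le> D"
      using continuous_on_compact_bound[OF compact_Icc smooth_fun_continuous_on[OF S], of "-1" 1]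
      by (metis real_norm_def)
    have "0 \<le> D" using D[of 0] by auto
    have [measurable]: "S \<in> borel_measurable borel"
      by (intro borel_measurable_continuous_onI smooth_fun_continuous_on S)
    show ?thesis
    proof (rule Bochner_Integration.integrable_bound)
      show "integrable lborel (\<lambda>x. D * norm (g x))" using g(1) by auto
      show "AE x in lborel. norm (complex_of_real (S x) * g x) \<le> norm (D * norm (g x))"
      proof (rule AE_I2)
        show "norm (complex_of_real (S x) * g x) \<le> norm (D * norm (g x))" for x
          using D[of x] g(2)[of x] \<open>0 \<le> D\<close> by (cases "\<bar>x\<bar> \<le> 1") (auto simp: norm_mult abs_mult abs_le_iff intro!: mult_right_mono)
      qed
    qed measurable
  qed
  have "(LINT x|lborel. (LINT y:{..x}|lborel. g y) * complex_of_real (S' x)) = (LINT x|lborel. LINT y|lborel. k x y)"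
    by (simp add: left)
  also have "\<dots> = (LINT y|lborel. LINT x|lborel. k x y)"
    by (rule lborel_pair.Fubini_integral[OF kint, symmetric])
  also have "\<dots> = (LINT y|lborel. complex_of_real (S 1) * g y - complex_of_real (S y) * g y)"
    by (simp add: right algebra_simps)
  also have "\<dots> = - (LINT y|lborel. g y * complex_of_real (S y))"
    using g gS by (subst Bochner_Integration.integral_diff) (auto simp: mult.commute)
  finally show ?thesis by (simp add: S'_def)
qed

text \<open>The primitive \<open>h\<close> of \<open>g\<close> satisfies the same tested identity as
  \<open>f\<close>, so f - h is orthogonal to every derivative of a smooth function. Every smooth
  function is such a derivative; smooth steps approximating indicators of rays then give f = h
  almost everywhere.\<close>

lemma weak_deriv_primitive:
  assumes wd: "weak_deriv f f'" and supp: "compact_supp_in f"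
  obtains g where "g \<in> borel_measurable borel" "\<And>x. 1 < \<bar>x\<bar> \<Longrightarrow> g x = 0" "integrable lborel (\<lambda>x. (cmod (g x))\<^sup>2)"
    "(LINT x|lborel. (cmod (g x))\<^sup>2) \<le> L2_norm_sq f'" "integrable lborel g" "(LINT x|lborel. g x) = 0"
    "AE x in lborel. f x = (LINT y:{..x}|lborel. g y)"
proof -
  obtain g where g: "g \<in> borel_measurable borel" "\<And>x. 1 < \<bar>x\<bar> \<Longrightarrow> g x = 0" "integrable lborel (\<lambda>x. (cmod (g x))\<^sup>2)"
    "(LINT x|lborel. (cmod (g x))\<^sup>2) \<le> L2_norm_sq f'" "integrable lborel g"
    and test: "\<And>S. smooth_fun S \<Longrightarrow> (LINT x|lborel. f x * complex_of_real (deriv S x)) = - (LINT x|lborel. g x * complex_of_real (S x))"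
    by (rule weak_deriv_smooth_test[OF assms]) (rule that; assumption)
  \<comment> \<open>The constant 1 is a legitimate test function here, although it has no compact
    support, and its derivative vanishes.\<close>
  have g0: "(LINT x|lborel. g x) = 0"
    using test[OF smooth_fun_const[of 1]] by simp
  define h where "h x = (LINT y:{..x}|lborel. g y)" for x
  have [measurable]: "g \<in> borel_measurable borel" by fact
  have hm [measurable]: "h \<in> borel_measurable borel"
    unfolding h_def[abs_def] by (rule primitive_measurable[OF g(1)])
  have hb: "cmod (h x) \<le> (LINT y|lborel. cmod (g y))" for x
    unfolding h_def by (rule primitive_bound[OF g(5)])
  have h0: "h x = 0" if "\<not> (-1 \<le> x \<and> x \<le> 1)" for x
    unfolding h_def using that by (intro primitive_eq_0[OF g(2) g0]) auto
  have hi: "integrable lborel h"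
    by (rule integrableI_bounded_set[where A = "{-1..1}" and B = "LINT y|lborel. cmod (g y)"])
       (use hb h0 in auto)
  have f_ind: "f = (\<lambda>x. indicat_real {-1..1} x *\<^sub>R f x)"
    using supp unfolding compact_supp_in_def by (force simp: indicator_def)
  have fi: "integrable lborel f"
    using L2_on_integrable[of f] wd f_ind by (simp add: weak_deriv_def)
  have ortho: "(LINT x|lborel. (f x - h x) * complex_of_real (B x)) = 0"
    if B: "smooth_fun B" "\<And>x. 0 \<le> B x" "\<And>x. B x \<le> 1" for B
  proof -
    \<comment> \<open>Writing B as S' brings the pairing with B into the form that both identities
      control.\<close>
    obtain S where S: "smooth_fun S" "\<And>x. (S has_real_derivative B x) (at x)"
      using smooth_antiderivative_exists[OF B(1)] by metis
    then have dS: "deriv S = B" by (auto intro: DERIV_imp_deriv)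
    have [measurable]: "B \<in> borel_measurable borel"
      by (intro borel_measurable_continuous_onI smooth_fun_continuous_on B)
    have int: "integrable lborel (\<lambda>x. u x * complex_of_real (B x))" if "integrable lborel u" for u :: "real \<Rightarrow> complex"
      using that
      by (rule Bochner_Integration.integrable_bound)
         (use that B in \<open>auto simp: norm_mult intro!: AE_I2 mult_left_le\<close>)
    have "(LINT x|lborel. f x * complex_of_real (B x)) = (LINT x|lborel. h x * complex_of_real (B x))"
      using test[OF S(1)] integral_primitive_mult_deriv[OF g(5,2) g0 S(1)] by (simp add: dS h_def)
    then show ?thesis
      using int[OF fi] int[OF hi] by (simp add: left_diff_distrib)
  qed
  obtain B :: "real \<Rightarrow> real" where B: "smooth_fun B" "\<And>x. x \<le> 0 \<Longrightarrow> B x = 0" "\<And>x. 1 \<le> x \<Longrightarrow> B x = 1"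
    "\<And>x. 0 \<le> B x" "\<And>x. B x \<le> 1"
    using smooth_step_exists by blast
  have [measurable]: "B \<in> borel_measurable borel" "f \<in> borel_measurable borel"
    using fi by (auto intro!: borel_measurable_continuous_onI smooth_fun_continuous_on B)
  have "AE x in lborel. f x - h x = 0"
  proof (rule AE_zero_if_integrals_greaterThan_zero)
    show "integrable lborel (\<lambda>x. f x - h x)" using fi hi by simp
    fix c
    \<comment> \<open>The steps B(n(x - c)) converge pointwise to the indicator of the open ray; at
      x = c they equal B(0) = 0, which fits the open end.\<close>
    have "(\<lambda>n. LINT x|lborel. (f x - h x) * complex_of_real (B (real n * x + (- real n * c))))
        \<longlonglongrightarrow> (LINT x:{c<..}|lborel. f x - h x)"
      unfolding set_lebesgue_integral_def
    proof (rule integral_dominated_convergence[where w = "\<lambda>x. norm (f x - h x)"])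
      show "AE x in lborel. (\<lambda>n. (f x - h x) * complex_of_real (B (real n * x + (- real n * c))))
          \<longlonglongrightarrow> indicat_real {c<..} x *\<^sub>R (f x - h x)"
      proof (rule AE_I2)
        fix x :: real
        have "\<forall>\<^sub>F n in sequentially. B (real n * x + (- real n * c)) = indicat_real {c<..} x"
        proof (cases "c < x")
          case True
          obtain N where N: "1 / (x - c) < real N" using reals_Archimedean2 by blast
          show ?thesis
            using eventually_ge_at_top[of N]
          proof eventually_elim
            case (elim n)
            then have "1 / (x - c) \<le> real n" using N by linarith
            then have "1 \<le> real n * (x - c)" using True by (simp add: field_simps)
            then show ?case using True by (simp add: B(3) algebra_simps)
          qed
        next
          case False
          then have "real n * x + (- real n * c) \<le> 0" for n by (simp add: mult_left_mono)
          then show ?thesis using False by (simp add: B(2))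
        qed
        then have "\<forall>\<^sub>F n in sequentially. (f x - h x) * complex_of_real (B (real n * x + (- real n * c)))
            = indicat_real {c<..} x *\<^sub>R (f x - h x)"
          by eventually_elim (simp add: scaleR_conv_of_real mult.commute)
        then show "(\<lambda>n. (f x - h x) * complex_of_real (B (real n * x + (- real n * c))))
          \<longlonglongrightarrow> indicat_real {c<..} x *\<^sub>R (f x - h x)"
          by (rule tendsto_eventually)
      qed
      show "integrable lborel (\<lambda>x. norm (f x - h x))" using fi hi by simp
      show "AE x in lborel. norm ((f x - h x) * complex_of_real (B (real n * x + (- real n * c)))) \<le> norm (f x - h x)" for n
        using B(4,5) by (auto simp: norm_mult intro!: AE_I2 mult_left_le)
    qed measurable
    moreover have "(LINT x|lborel. (f x - h x) * complex_of_real (B (real n * x + (- real n * c)))) = 0" for n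
      by (rule ortho[OF smooth_fun_affine[OF B(1)] B(4) B(5)])
    ultimately show "(LINT x:{c<..}|lborel. f x - h x) = 0"
      by (simp add: LIMSEQ_const_iff)
  qed
  then have "AE x in lborel. f x = (LINT y:{..x}|lborel. g y)" by eventually_elim (simp add: h_def)
  then show ?thesis using that g g0 by blast
qed

section \<open>The Fourier transform and its extrapolation\<close>

definition fourier :: "(real \<Rightarrow> complex) \<Rightarrow> real \<Rightarrow> complex" where
  "fourier h \<xi> = (CLINT y|lborel. iexp (- (\<xi> * y)) * h y)"

text \<open>The bound on \<open>u\<close> is asked for only where \<open>h\<close> is nonzero. This
  lets kernels such as Taylor remainders, which are small only for |y| \<le> 1, be estimated on the
  support.\<close>

lemma integrable_bounded_mult:
  fixes u h :: "real \<Rightarrow> complex"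
  assumes h: "integrable lborel h" and u: "u \<in> borel_measurable borel"
    and bound: "\<And>y. h y \<noteq> 0 \<Longrightarrow> cmod (u y) \<le> B"
  shows "integrable lborel (\<lambda>y. u y * h y)"
    and "cmod (LINT y|lborel. u y * h y) \<le> B * (LINT y|lborel. cmod (h y))"
proof -
  have le: "norm (u y * h y) \<le> B * cmod (h y)" for y
    using bound[of y] by (cases "h y = 0") (auto simp: norm_mult intro: mult_right_mono)
  have int: "integrable lborel (\<lambda>y. B * cmod (h y))" using h by auto
  show int': "integrable lborel (\<lambda>y. u y * h y)"
    by (rule Bochner_Integration.integrable_bound[OF int]) (use h u le in \<open>auto intro!: AE_I2 order_trans[OF _ abs_ge_self]\<close>)
  have "cmod (LINT y|lborel. u y * h y) \<le> (LINT y|lborel. norm (u y * h y))"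
    by (rule integral_norm_bound)
  also have "\<dots> \<le> (LINT y|lborel. B * cmod (h y))"
    by (rule integral_mono[OF integrable_norm[OF int'] int le])
  finally show "cmod (LINT y|lborel. u y * h y) \<le> B * (LINT y|lborel. cmod (h y))" by simp
qed

lemma fourier_integrable:
  assumes "integrable lborel h"
  shows "integrable lborel (\<lambda>y. iexp (- (\<xi> * y)) * h y)"
  by (rule integrable_bounded_mult[OF assms, where B = 1]) auto

lemma fourier_bound:
  assumes "integrable lborel h"
  shows "cmod (fourier h \<xi>) \<le> (LINT y|lborel. cmod (h y))"
  using integrable_bounded_mult(2)[OF assms, of "\<lambda>y. iexp (- (\<xi> * y))" 1]
  unfolding fourier_def by simp

lemma fourier_lipschitz:
  assumes h: "integrable lborel h" and supp: "\<And>y. 1 < \<bar>y\<bar> \<Longrightarrow> h y = 0"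
  shows "cmod (fourier h \<xi> - fourier h \<eta>) \<le> \<bar>\<xi> - \<eta>\<bar> * (LINT y|lborel. cmod (h y))"
proof -
  have "fourier h \<xi> - fourier h \<eta> = (LINT y|lborel. (iexp (- (\<xi> * y)) - iexp (- (\<eta> * y))) * h y)"
    unfolding fourier_def
    unfolding left_diff_distrib
    by (rule Bochner_Integration.integral_diff[symmetric]) (rule fourier_integrable[OF h])+
  moreover have "cmod (iexp (- (\<xi> * y)) - iexp (- (\<eta> * y))) \<le> \<bar>\<xi> - \<eta>\<bar>" if "h y \<noteq> 0" for y
  proof -
    have "iexp (- (\<xi> * y)) - iexp (- (\<eta> * y)) = iexp (- (\<eta> * y)) * (iexp ((\<eta> - \<xi>) * y) - 1)"
      by (simp add: right_diff_distrib exp_add[symmetric]) (simp add: algebra_simps)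
    then have "cmod (iexp (- (\<xi> * y)) - iexp (- (\<eta> * y))) = cmod (iexp ((\<eta> - \<xi>) * y) - 1)"
      by (simp only: norm_mult norm_exp_i_times mult_1)
    also have "\<dots> \<le> \<bar>(\<eta> - \<xi>) * y\<bar>"
      using iexp_approx1[of "(\<eta> - \<xi>) * y" 0] by simp
    also have "\<dots> \<le> \<bar>\<xi> - \<eta>\<bar>"
      using supp[of y] that by (cases "1 < \<bar>y\<bar>") (auto simp: abs_mult abs_minus_commute intro!: mult_left_le)
    finally show ?thesis .
  qed
  ultimately show ?thesis
    using integrable_bounded_mult(2)[OF h, of "\<lambda>y. iexp (- (\<xi> * y)) - iexp (- (\<eta> * y))" "\<bar>\<xi> - \<eta>\<bar>"]
    by simp
qed

lemma fourier_continuous_on: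
  assumes h: "integrable lborel h" and supp: "\<And>y. 1 < \<bar>y\<bar> \<Longrightarrow> h y = 0"
  shows "continuous_on S (fourier h)"
proof (rule lipschitz_on_continuous_on)
  show "(LINT y|lborel. cmod (h y))-lipschitz_on S (fourier h)"
    by (rule lipschitz_onI) (use fourier_lipschitz[OF assms] in \<open>auto simp: dist_norm mult.commute\<close>)
qed

text \<open>The exponential is expanded under the integral, so the coefficients are moments of
  \<open>h\<close>; |y| \<le> 1 on the support removes y from the remainder.\<close>

lemma fourier_taylor_polynomial:
  assumes h: "integrable lborel h" and supp: "\<And>y. 1 < \<bar>y\<bar> \<Longrightarrow> h y = 0"
  obtains P :: "complex poly" where "degree P \<le> N"
    "\<And>\<xi>. cmod (fourier h \<xi> - poly P (of_real \<xi>)) \<le> \<bar>\<xi>\<bar> ^ Suc N / fact (Suc N) * (LINT y|lborel. cmod (h y))"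
proof
  define c where "c k = (- \<i>) ^ k / fact k * (LINT y|lborel. of_real (y ^ k) * h y)" for k :: nat
  define P where "P = (\<Sum>k\<le>N. monom (c k) k)"
  show "degree P \<le> N"
    unfolding P_def by (rule degree_sum_le) (auto intro: order_trans[OF degree_monom_le])
  fix \<xi> :: real
  define T where "T y = (\<Sum>k\<le>N. (\<i> * of_real (- (\<xi> * y))) ^ k / fact k)" for y
  have int: "integrable lborel (\<lambda>y. complex_of_real (y ^ k) * h y)" for k
  proof (rule integrable_bounded_mult[OF h, where B = 1])
    show "cmod (complex_of_real (y ^ k)) \<le> 1" if "h y \<noteq> 0" for y
      using supp[of y] that by (cases "1 < \<bar>y\<bar>") (auto simp: norm_power intro!: power_le_one)
  qed measurable
  have T_term: "(\<i> * of_real (- (\<xi> * y))) ^ k / fact k * h y =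
      ((- \<i>) ^ k / fact k * of_real \<xi> ^ k) * (of_real (y ^ k) * h y)" for k y
  proof -
    have "\<i> * complex_of_real (- (\<xi> * y)) = (- \<i>) * complex_of_real \<xi> * complex_of_real y" by simp
    then show ?thesis by (simp only: power_mult_distrib of_real_power) simp
  qed
  have Tint: "integrable lborel (\<lambda>y. T y * h y)"
    unfolding T_def sum_distrib_right T_term by (intro Bochner_Integration.integrable_sum integrable_mult_right int)
  have "poly P (of_real \<xi>) = (\<Sum>k\<le>N. ((- \<i>) ^ k / fact k * of_real \<xi> ^ k) * (LINT y|lborel. of_real (y ^ k) * h y))"
    by (simp add: P_def c_def poly_sum poly_monom mult_ac)
  also have "\<dots> = (LINT y|lborel. T y * h y)"
    unfolding T_def sum_distrib_right T_term
    by (subst Bochner_Integration.integral_sum) (rule integrable_mult_right int refl integral_mult_right_zero[symmetric] sum.cong | simp only: integral_mult_right_zero)+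
  finally have P_int: "poly P (of_real \<xi>) = (LINT y|lborel. T y * h y)" .
  have eq: "fourier h \<xi> - poly P (of_real \<xi>) = (LINT y|lborel. (iexp (- (\<xi> * y)) - T y) * h y)"
    unfolding fourier_def left_diff_distrib P_int
    by (rule Bochner_Integration.integral_diff[symmetric]) (rule fourier_integrable[OF h] Tint)+
  have rem: "cmod (iexp (- (\<xi> * y)) - T y) \<le> \<bar>\<xi>\<bar> ^ Suc N / fact (Suc N)" if "h y \<noteq> 0" for y
  proof -
    have "cmod (iexp (- (\<xi> * y)) - T y) \<le> \<bar>- (\<xi> * y)\<bar> ^ Suc N / fact (Suc N)"
      unfolding T_def by (rule iexp_approx1)
    also have "\<dots> \<le> \<bar>\<xi>\<bar> ^ Suc N / fact (Suc N)"
    proof (intro divide_right_mono power_mono)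
      show "\<bar>- (\<xi> * y)\<bar> \<le> \<bar>\<xi>\<bar>"
        using supp[of y] that by (cases "1 < \<bar>y\<bar>") (auto simp: abs_mult intro!: mult_left_le)
    qed auto
    finally show ?thesis .
  qed
  have meas: "(\<lambda>y. iexp (- (\<xi> * y)) - T y) \<in> borel_measurable borel"
    unfolding T_def by measurable
  show "cmod (fourier h \<xi> - poly P (of_real \<xi>)) \<le> \<bar>\<xi>\<bar> ^ Suc N / fact (Suc N) * (LINT y|lborel. cmod (h y))"
    unfolding eq by (rule integrable_bounded_mult(2)[OF h meas rem])
qed

section \<open>Lagrange interpolation and growth of polynomials\<close>

lemma prod_of_nat_diff:
  assumes "j \<le> N"
  shows "(\<Prod>i\<in>{..N} - {j}. \<bar>real j - real i\<bar>) = fact j * fact (N - j)"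
proof -
  have eq: "{..N} - {j} = {..<j} \<union> {Suc j..N}" using assms by auto
  have "(\<Prod>i\<in>{..N} - {j}. \<bar>real j - real i\<bar>) = (\<Prod>i<j. \<bar>real j - real i\<bar>) * (\<Prod>i\<in>{Suc j..N}. \<bar>real j - real i\<bar>)"
    unfolding eq by (rule prod.union_disjoint) auto
  also have "(\<Prod>i<j. \<bar>real j - real i\<bar>) = (\<Prod>i\<in>{1..j}. real i)"
    by (rule prod.reindex_bij_witness[of _ "\<lambda>i. j - i" "\<lambda>i. j - i"]) auto
  also have "(\<Prod>i\<in>{Suc j..N}. \<bar>real j - real i\<bar>) = (\<Prod>i\<in>{1..N - j}. real i)"
    by (rule prod.reindex_bij_witness[of _ "\<lambda>i. i + j" "\<lambda>i. i - j"]) (use assms in auto)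
  finally show ?thesis by (simp add: fact_prod)
qed

text \<open>The difference of P and its interpolant has degree at most N but N + 1 zeros.\<close>

lemma poly_lagrange_nat:
  fixes P :: "complex poly"
  assumes "degree P \<le> N"
  shows "poly P z = (\<Sum>j\<le>N. poly P (of_nat j) * (\<Prod>i\<in>{..N} - {j}. (z - of_nat i) / (of_nat j - of_nat i)))"
proof -
  define c where "c j = poly P (of_nat j) / (\<Prod>i\<in>{..N} - {j}. of_nat j - of_nat i)" for j
  define L where "L = (\<Sum>j\<le>N. smult (c j) (\<Prod>i\<in>{..N} - {j}. [:- of_nat i, 1:]))"
  have poly_L: "poly L w = (\<Sum>j\<le>N. poly P (of_nat j) * (\<Prod>i\<in>{..N} - {j}. (w - of_nat i) / (of_nat j - of_nat i)))" for w
    by (simp add: L_def c_def poly_sum poly_prod prod_dividef)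
  have "P - L = 0"
  proof (rule ccontr)
    assume ne: "P - L \<noteq> 0"
    have "degree L \<le> N"
      unfolding L_def
    proof (rule degree_sum_le)
      fix j assume j: "j \<in> {..N}"
      have "degree (smult (c j) (\<Prod>i\<in>{..N} - {j}. [:- of_nat i, 1:])) \<le> degree (\<Prod>i\<in>{..N} - {j}. [:- of_nat i, 1::complex:])"
        by (rule degree_smult_le)
      also have "\<dots> \<le> (\<Sum>i\<in>{..N} - {j}. degree [:- of_nat i, 1::complex:])"
        by (rule degree_prod_sum_le[unfolded o_def]) simp
      also have "\<dots> = N" using j by simp
      finally show "degree (smult (c j) (\<Prod>i\<in>{..N} - {j}. [:- of_nat i, 1:])) \<le> N" .
    qed simp
    then have "degree (P - L) \<le> N" using assms by (simp add: degree_diff_le)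
    moreover have "poly (P - L) (of_nat k) = 0" if k: "k \<le> N" for k
    proof -
      have "(\<Prod>i\<in>{..N} - {j}. (of_nat k - of_nat i) / (of_nat j - of_nat i)) = (if j = k then 1 else (0::complex))" for j
        using k by auto
      then show ?thesis using k by (simp add: poly_L mult_delta_right)
    qed
    then have "of_nat ` {..N} \<subseteq> {x. poly (P - L) x = 0}" by auto
    then have "card (of_nat ` {..N} :: complex set) \<le> card {x. poly (P - L) x = 0}"
      by (rule card_mono[OF poly_roots_finite[OF ne]])
    then have "Suc N \<le> card {x. poly (P - L) x = 0}"
      by (simp add: card_image inj_on_def)
    ultimately show False using card_poly_roots_bound[OF ne] by linarith
  qed
  then show ?thesis using poly_L[of z] by simp
qed

lemma sum_inverse_fact_mult:
  "(\<Sum>j\<le>N. 1 / (fact j * fact (N - j))) = (2::real) ^ N / fact N"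
proof -
  have "(2::real) ^ N = (\<Sum>j\<le>N. real (N choose j))"
    using choose_row_sum[of N] by (metis of_nat_numeral of_nat_power of_nat_sum)
  also have "\<dots> = (\<Sum>j\<le>N. fact N * (1 / (fact j * fact (N - j))))"
    by (intro sum.cong) (auto simp: binomial_fact)
  also have "\<dots> = fact N * (\<Sum>j\<le>N. 1 / (fact j * fact (N - j)))" by (rule sum_distrib_left[symmetric])
  finally show ?thesis by (simp del: of_nat_fact)
qed

text \<open>One term of the exponential series. At x = n it gives n^n \<le> e^n n!, which replaces
  Stirling's formula.\<close>

lemma power_le_exp_mult_fact:
  fixes x :: real
  assumes "0 \<le> x"
  shows "x ^ n \<le> exp x * fact n"
proof -
  have "x ^ n / fact n \<le> (\<Sum>k. x ^ k / fact k)"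
    using sum_le_suminf[of "\<lambda>k. x ^ k / fact k" "{n}"] summable_exp[of x] assms
    by (simp add: divide_inverse mult.commute)
  also have "\<dots> = exp x" by (simp add: exp_def divide_inverse mult.commute)
  finally show ?thesis by (simp add: field_simps)
qed

text \<open>A Remez-type inequality with a crude constant. Rescaling by N turns the nodes j/N into
  integers. Each of the N numerators is at most 2sN, the denominators multiply to j!(N-j)!, and
  their reciprocals sum to 2^N/N!. Together this is (4s)^N N^N/N!, and N^N/N! \<le> e^N.\<close>

lemma poly_growth_from_unit_interval:
  fixes P :: "complex poly"
  assumes deg: "degree P \<le> N" and N: "0 < N" and s: "1 \<le> s" and x: "\<bar>x\<bar> \<le> s"
    and m: "\<And>t. 0 \<le> t \<Longrightarrow> t \<le> 1 \<Longrightarrow> cmod (poly P (of_real t)) \<le> m"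
  shows "cmod (poly P (of_real x)) \<le> m * (4 * exp 1 * s) ^ N"
proof -
  define Q where "Q = P \<circ>\<^sub>p [:0, of_real (1 / real N):]"
  have Q: "poly Q (of_real t) = poly P (of_real (t / real N))" for t
    by (simp add: Q_def poly_pcompose)
  have "degree Q \<le> N"
    using deg degree_pcompose_le[of P "[:0, of_real (1 / real N):]"] N by (simp add: Q_def)
  have m0: "0 \<le> m" using order_trans[OF norm_ge_zero m[of 0]] by simp
  have "cmod (poly P (of_real x)) = cmod (poly Q (of_real (x * real N)))"
    using N unfolding Q by simp
  also have "\<dots> = cmod (\<Sum>j\<le>N. poly Q (of_nat j) * (\<Prod>i\<in>{..N} - {j}. (of_real (x * real N) - of_nat i) / (of_nat j - of_nat i)))"
    by (subst poly_lagrange_nat[OF \<open>degree Q \<le> N\<close>]) simp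
  also have "\<dots> \<le> (\<Sum>j\<le>N. cmod (poly Q (of_nat j)) * (\<Prod>i\<in>{..N} - {j}. cmod ((of_real (x * real N) - of_nat i) / (of_nat j - of_nat i))))"
    by (rule order_trans[OF norm_sum]) (simp add: norm_mult prod_norm)
  also have "\<dots> \<le> (\<Sum>j\<le>N. m * ((2 * s * real N) ^ N * (1 / (fact j * fact (N - j)))))"
  proof (rule sum_mono)
    fix j assume "j \<in> {..N}"
    then have j: "j \<le> N" by simp
    have "cmod (poly Q (of_nat j)) \<le> m"
      using Q[of "real j"] m[of "real j / real N"] j N by simp
    moreover have "(\<Prod>i\<in>{..N} - {j}. cmod ((of_real (x * real N) - of_nat i) / (of_nat j - of_nat i)))
        \<le> (\<Prod>i\<in>{..N} - {j}. (2 * s * real N) / \<bar>real j - real i\<bar>)"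
    proof (rule prod_mono, safe)
      fix i assume i: "i \<le> N"
      have "cmod (of_nat j - of_nat i) = \<bar>real j - real i\<bar>"
        by (metis norm_of_real of_real_diff of_real_of_nat_eq)
      moreover have "cmod (of_real (x * real N) - of_nat i) \<le> 2 * s * real N"
      proof -
        have "cmod (of_real (x * real N) - of_nat i) \<le> \<bar>x * real N\<bar> + real i"
          by (metis norm_of_nat norm_of_real norm_triangle_ineq4)
        also have "\<bar>x * real N\<bar> \<le> s * real N" using x by (simp add: abs_mult mult_right_mono)
        also have "real i \<le> s * real N" using i s mult_right_mono[of 1 s "real N"] by linarith
        finally show ?thesis by simp
      qed
      ultimately show "cmod ((of_real (x * real N) - of_nat i) / (of_nat j - of_nat i)) \<le> (2 * s * real N) / \<bar>real j - real i\<bar>"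
        by (simp add: norm_divide divide_right_mono)
    qed auto
    moreover have "(\<Prod>i\<in>{..N} - {j}. (2 * s * real N) / \<bar>real j - real i\<bar>) = (2 * s * real N) ^ N * (1 / (fact j * fact (N - j)))"
      using j by (simp add: prod_dividef prod_of_nat_diff)
    ultimately show "cmod (poly Q (of_nat j)) * (\<Prod>i\<in>{..N} - {j}. cmod ((of_real (x * real N) - of_nat i) / (of_nat j - of_nat i)))
        \<le> m * ((2 * s * real N) ^ N * (1 / (fact j * fact (N - j))))"
      using m0 by (intro mult_mono) (auto intro: prod_nonneg)
  qed
  also have "\<dots> = m * ((2 * s * real N) ^ N * (2 ^ N / fact N))"
    by (simp only: sum_distrib_left[symmetric] sum_inverse_fact_mult)
  also have "\<dots> = m * ((4 * s) ^ N * (real N ^ N / fact N))"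
  proof -
    have "2 * s * real N * 2 = (4 * s) * real N" by simp
    then have "(2 * s * real N) ^ N * 2 ^ N = (4 * s) ^ N * real N ^ N"
      by (simp only: power_mult_distrib[symmetric])
    then show ?thesis by (simp only: times_divide_eq_right)
  qed
  also have "\<dots> \<le> m * ((4 * s) ^ N * exp 1 ^ N)"
  proof -
    have "real N ^ N / fact N \<le> exp 1 ^ N"
      using power_le_exp_mult_fact[of "real N" N] by (simp add: field_simps exp_of_nat_mult[symmetric])
    then show ?thesis using m0 s by (intro mult_left_mono) auto
  qed
  also have "\<dots> = m * (4 * exp 1 * s) ^ N" by (simp add: power_mult_distrib mult_ac)
  finally show ?thesis .
qed

text \<open>The Taylor error is paid twice: on [0,1], where it is at most A/N! and is then amplified
  with the polynomial, and at x itself, where it is at most s^(N+1) A/N!. As s \<le> 4es, both fit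
  under the same growth factor.\<close>

lemma fourier_extrapolation:
  assumes h: "integrable lborel h" and supp: "\<And>y. 1 < \<bar>y\<bar> \<Longrightarrow> h y = 0"
    and A: "(LINT y|lborel. cmod (h y)) \<le> A"
    and N: "0 < N" and s: "1 \<le> s" and x: "\<bar>x\<bar> \<le> s"
    and m: "\<And>t. 0 \<le> t \<Longrightarrow> t \<le> 1 \<Longrightarrow> cmod (fourier h t) \<le> m"
  shows "cmod (fourier h x) \<le> (4 * exp 1 * s) ^ N * (m + 2 * s * A / fact N)"
proof -
  have A0: "0 \<le> A" using A order_trans[OF integral_nonneg_AE A] by simp
  obtain P :: "complex poly" where P: "degree P \<le> N"
    "\<And>\<xi>. cmod (fourier h \<xi> - poly P (of_real \<xi>)) \<le> \<bar>\<xi>\<bar> ^ Suc N / fact (Suc N) * (LINT y|lborel. cmod (h y))"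
    using fourier_taylor_polynomial[OF h supp] by blast
  have err: "cmod (fourier h \<xi> - poly P (of_real \<xi>)) \<le> \<bar>\<xi>\<bar> ^ Suc N * (A / fact N)" for \<xi>
  proof -
    have "cmod (fourier h \<xi> - poly P (of_real \<xi>)) \<le> \<bar>\<xi>\<bar> ^ Suc N / fact (Suc N) * A"
      by (rule order_trans[OF P(2)]) (rule mult_left_mono[OF A], simp)
    also have "\<dots> \<le> \<bar>\<xi>\<bar> ^ Suc N / fact N * A"
      using A0 by (intro mult_right_mono divide_left_mono fact_mono) auto
    finally show ?thesis by simp
  qed
  have unit: "cmod (poly P (of_real t)) \<le> m + A / fact N" if "0 \<le> t" "t \<le> 1" for t
  proof -
    have "cmod (poly P (of_real t)) \<le> cmod (fourier h t) + cmod (fourier h t - poly P (of_real t))"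
      by (metis norm_minus_commute norm_triangle_sub)
    moreover have "\<bar>t\<bar> ^ Suc N * (A / fact N) \<le> 1 * (A / fact N)"
      using that A0 by (intro mult_right_mono power_le_one) auto
    ultimately show ?thesis using m[OF that] err[of t] by linarith
  qed
  have base: "s ^ N \<le> (4 * exp 1 * s) ^ N"
  proof (rule power_mono)
    have "1 \<le> 4 * exp (1::real)" using one_le_exp_iff[of "1::real"] by linarith
    then show "s \<le> 4 * exp 1 * s" using s mult_right_mono[of 1 "4 * exp 1" s] by simp
  qed (use s in simp)
  have "cmod (fourier h x) \<le> cmod (poly P (of_real x)) + cmod (fourier h x - poly P (of_real x))"
    by (metis norm_triangle_sub)
  also have "cmod (poly P (of_real x)) \<le> (m + A / fact N) * (4 * exp 1 * s) ^ N"
    by (rule poly_growth_from_unit_interval[OF P(1) N s x unit])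
  also have "cmod (fourier h x - poly P (of_real x)) \<le> s * (4 * exp 1 * s) ^ N * (A / fact N)"
  proof (rule order_trans[OF err mult_right_mono])
    have "\<bar>x\<bar> ^ Suc N \<le> s ^ Suc N" using x by (intro power_mono) auto
    also have "\<dots> \<le> s * (4 * exp 1 * s) ^ N" using base s by simp
    finally show "\<bar>x\<bar> ^ Suc N \<le> s * (4 * exp 1 * s) ^ N" .
  qed (use A0 in simp)
  also have "(m + A / fact N) * (4 * exp 1 * s) ^ N + s * (4 * exp 1 * s) ^ N * (A / fact N)
      = (4 * exp 1 * s) ^ N * (m + (A / fact N + s * (A / fact N)))"
    by (simp add: algebra_simps)
  also have "\<dots> \<le> (4 * exp 1 * s) ^ N * (m + 2 * s * A / fact N)"
  proof -
    have "1 * (A / fact N) \<le> s * (A / fact N)" using s A0 by (intro mult_right_mono) auto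
    moreover have "2 * s * A / fact N = s * (A / fact N) + s * (A / fact N)" by simp
    ultimately have "m + (A / fact N + s * (A / fact N)) \<le> m + 2 * s * A / fact N" by linarith
    then show ?thesis using s by (intro mult_left_mono) auto
  qed
  finally show ?thesis by simp
qed

text \<open>If m = |F(x)|, then |F| \<ge> m/2 on an interval of length r = m/(2A) ending at x, so
  the integral is at least r (m/2)^2 = m^3/(8A).\<close>

lemma lipschitz_sup_le_integral:
  fixes F :: "real \<Rightarrow> complex"
  assumes lip: "\<And>x y. cmod (F x - F y) \<le> \<bar>x - y\<bar> * A" and bound: "\<And>x. cmod (F x) \<le> A" and A: "0 < A"
    and x: "0 \<le> x" "x \<le> 1"
  shows "cmod (F x) ^ 3 \<le> 8 * A * (LINT t:{0..1}|lborel. (cmod (F t))\<^sup>2)"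
proof -
  define m where "m = cmod (F x)"
  define r where "r = m / (2 * A)"
  have r: "0 \<le> r" "r \<le> 1 / 2" using bound[of x] A by (auto simp: r_def m_def field_simps)
  \<comment> \<open>Since r \<le> 1/2, the interval fits into [0,1] when placed to the right of x in
    the left half and to the left of x otherwise.\<close>
  define l where "l = (if x \<le> 1 / 2 then x else x - r)"
  have l: "0 \<le> l" "l + r \<le> 1" using r x by (auto simp: l_def)
  have near: "m / 2 \<le> cmod (F t)" if "t \<in> {l..l + r}" for t
  proof -
    have "\<bar>x - t\<bar> \<le> r" using that by (auto simp: l_def split: if_splits)
    then have "\<bar>x - t\<bar> * A \<le> r * A" using A by simp
    then have "cmod (F x - F t) \<le> m / 2" using lip[of x t] A by (simp add: r_def)
    then show ?thesis using norm_triangle_ineq2[of "F x" "F t"] by (simp add: m_def)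
  qed
  have cont: "continuous_on S (\<lambda>t. (cmod (F t))\<^sup>2)" for S
  proof -
    have "A-lipschitz_on S F"
      by (rule lipschitz_onI) (use lip A in \<open>auto simp: dist_norm mult.commute\<close>)
    then show ?thesis by (intro continuous_intros lipschitz_on_continuous_on)
  qed
  have int: "integrable lborel (\<lambda>t. indicat_real {0..1} t *\<^sub>R (cmod (F t))\<^sup>2)"
    using borel_integrable_compact[OF compact_Icc cont, of 0 1] by auto
  have "r * (m / 2)\<^sup>2 = (LINT t|lborel. indicat_real {l..l + r} t * (m / 2)\<^sup>2)"
    using r by simp
  also have "\<dots> \<le> (LINT t|lborel. indicat_real {0..1} t *\<^sub>R (cmod (F t))\<^sup>2)"
  proof (rule integral_mono[OF _ int])
    show "integrable lborel (\<lambda>t. indicat_real {l..l + r} t * (m / 2)\<^sup>2)"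
      using r by (intro integrable_mult_left) (simp add: integrable_indicator_iff)
    show "indicat_real {l..l + r} t * (m / 2)\<^sup>2 \<le> indicat_real {0..1} t *\<^sub>R (cmod (F t))\<^sup>2" for t
      using near[of t] l by (auto simp: indicator_def m_def intro!: power_mono)
  qed
  finally show ?thesis
    using A by (simp add: r_def m_def set_lebesgue_integral_def field_simps power2_eq_square power3_eq_cube)
qed

text \<open>With N the integer part of s^(4/3), the growth factor is exp(O(s^(4/3) ln s)), which
  loses against exp(-(2/3) s^(8/3)). The number 2/3 is a third of the 2 in exp(-2 s^(8/3)): passing
  from the integral to the supremum takes a cube root.\<close>

lemma extrapolation_factor_eventually:
  "\<forall>\<^sub>F s :: real in at_top. \<exists>N>0. (4 * exp 1 * s) ^ N * (4 * exp (- (2 / 3) * s powr (8 / 3)) + 2 * s / fact N) \<le> 1 / s\<^sup>2"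
proof -
  have "\<forall>\<^sub>F s::real in at_top.
      4 * (4 * exp 1 * s) powr (s powr (4 / 3)) * exp (- (2 / 3) * s powr (8 / 3))
      + 2 * s * exp (4 * (exp 1)\<^sup>2 * s - s powr (4 / 3) + 1) \<le> 1 / s\<^sup>2"
    by real_asymp
  then show ?thesis
    using eventually_ge_at_top[of 1]
  proof eventually_elim
    case (elim s)
    define t where "t = s powr (4 / 3)"
    define N where "N = nat \<lfloor>t\<rfloor>"
    have t: "1 \<le> t" using elim(2) by (simp add: t_def ge_one_powr_ge_zero)
    then have N: "0 < N" "real N \<le> t" "t < real N + 1" by (auto simp: N_def)
    have e: "1 \<le> exp (1::real)" by simp
    have base: "1 \<le> 4 * exp 1 * s" using mult_mono[of 1 "4 * exp 1" 1 s] e elim(2) by linarith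
    have "(4 * exp 1 * s) ^ N = (4 * exp 1 * s) powr real N" using elim(2) by (simp add: powr_realpow)
    also have "\<dots> \<le> (4 * exp 1 * s) powr t" using N(2) base by (rule powr_mono)
    finally have le1: "(4 * exp 1 * s) ^ N \<le> (4 * exp 1 * s) powr t" .
    \<comment> \<open>Multiplying by e^N turns (4es)^N into (4e^2 s)^N, one term of an exponential
      series up to N!. What remains is e^(-N), and N > t - 1 beats the linear exponent 4e^2 s
      because 4/3 > 1.\<close>
    have le2: "(4 * exp 1 * s) ^ N / fact N \<le> exp (4 * (exp 1)\<^sup>2 * s - t + 1)"
    proof -
      have "(4 * exp 1 * s) ^ N * exp (real N) = (4 * (exp 1)\<^sup>2 * s) ^ N"
        using exp_of_nat_mult[of N "1::real"]
        by (simp add: power_mult_distrib power2_eq_square)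
      also have "\<dots> \<le> exp (4 * (exp 1)\<^sup>2 * s) * fact N"
        using elim(2) by (intro power_le_exp_mult_fact) simp
      finally have "(4 * exp 1 * s) ^ N / fact N \<le> exp (4 * (exp 1)\<^sup>2 * s) / exp (real N)"
        by (simp add: field_simps)
      also have "\<dots> \<le> exp (4 * (exp 1)\<^sup>2 * s - t + 1)"
        using N(3) by (simp add: exp_diff[symmetric])
      finally show ?thesis .
    qed
    have "(4 * exp 1 * s) ^ N * (4 * exp (- (2 / 3) * s powr (8 / 3)) + 2 * s / fact N)
        = 4 * (4 * exp 1 * s) ^ N * exp (- (2 / 3) * s powr (8 / 3)) + 2 * s * ((4 * exp 1 * s) ^ N / fact N)"
      by (simp add: distrib_left)
    also have "\<dots> \<le> 4 * (4 * exp 1 * s) powr t * exp (- (2 / 3) * s powr (8 / 3)) + 2 * s * exp (4 * (exp 1)\<^sup>2 * s - t + 1)"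
      using le1 le2 elim(2) by (intro add_mono mult_left_mono mult_right_mono) auto
    also have "\<dots> \<le> 1 / s\<^sup>2" using elim(1) by (simp add: t_def)
    finally show ?case using N(1) by blast
  qed
qed

lemma fourier_low_frequency_bound:
  assumes hi: "integrable lborel h" and supp: "\<And>y. 1 < \<bar>y\<bar> \<Longrightarrow> h y = 0"
    and A: "(LINT y|lborel. cmod (h y)) \<le> A" "1 \<le> A" and s: "1 \<le> s"
    and small: "(LINT \<xi>:{0..1}|lborel. (cmod (fourier h \<xi>))\<^sup>2) \<le> 4 * exp (- 2 * s powr (8 / 3))"
    and N: "0 < N" "(4 * exp 1 * s) ^ N * (4 * exp (- (2 / 3) * s powr (8 / 3)) + 2 * s / fact N) \<le> 1 / s\<^sup>2"
  shows "(LINT \<xi>:{-s..s}|lborel. (cmod (fourier h \<xi>))\<^sup>2) \<le> 2 * A\<^sup>2 * s powr (- 4 / 3)"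
proof -
  \<comment> \<open>The cube root of the smallness of the data, matching the cube in the supremum
    estimate.\<close>
  define \<eta> where "\<eta> = exp (- (2 / 3) * s powr (8 / 3))"
  have \<eta>: "0 < \<eta>" "exp (- 2 * s powr (8 / 3)) = \<eta> ^ 3"
    by (auto simp: \<eta>_def exp_of_nat_mult[symmetric])
  have sup: "cmod (fourier h t) \<le> 4 * A * \<eta>" if "0 \<le> t" "t \<le> 1" for t
  proof -
    have "cmod (fourier h t) ^ 3 \<le> 8 * A * (LINT \<xi>:{0..1}|lborel. (cmod (fourier h \<xi>))\<^sup>2)"
    proof (rule lipschitz_sup_le_integral)
      show "cmod (fourier h x - fourier h y) \<le> \<bar>x - y\<bar> * A" for x y
        by (rule order_trans[OF fourier_lipschitz[OF hi supp] mult_left_mono[OF A(1)]]) auto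
      show "cmod (fourier h x) \<le> A" for x
        using fourier_bound[OF hi, of x] A(1) by linarith
    qed (use A that in auto)
    also have "\<dots> \<le> 8 * A * (4 * \<eta> ^ 3)"
      using small A(2) unfolding \<eta>(2) by (intro mult_left_mono) auto
    \<comment> \<open>8 * 4 = 32 is rounded up to 64 = 4^3, and A \<ge> 1 raises A to A^3.\<close>
    also have "\<dots> \<le> (4 * A * \<eta>) ^ 3"
    proof -
      have "A ^ 1 \<le> A ^ 3" using A(2) by (intro power_increasing) auto
      then have "A * \<eta> ^ 3 * 32 \<le> A ^ 3 * \<eta> ^ 3 * 64" using \<eta>(1) A(2) by (intro mult_mono) auto
      then show ?thesis by (simp add: power_mult_distrib)
    qed
    finally show ?thesis
      using power_le_imp_le_base[of "cmod (fourier h t)" 2 "4 * A * \<eta>"] A(2) \<eta>(1) by (simp add: numeral_3_eq_3)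
  qed
  have bound: "(cmod (fourier h x))\<^sup>2 \<le> A\<^sup>2 / s ^ 4" if "x \<in> {-s..s}" for x
  proof -
    have "cmod (fourier h x) \<le> (4 * exp 1 * s) ^ N * (4 * A * \<eta> + 2 * s * A / fact N)"
      by (rule fourier_extrapolation[OF hi supp A(1) N(1) s _ sup]) (use that in auto)
    also have "\<dots> = A * ((4 * exp 1 * s) ^ N * (4 * \<eta> + 2 * s / fact N))"
      by (simp add: algebra_simps)
    also have "\<dots> \<le> A * (1 / s\<^sup>2)"
      using N(2) A(2) unfolding \<eta>_def by (intro mult_left_mono) auto
    finally have "(cmod (fourier h x))\<^sup>2 \<le> (A * (1 / s\<^sup>2))\<^sup>2" by (rule power_mono) simp
    then show ?thesis by (simp add: power_mult_distrib power_divide flip: power_mult)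
  qed
  have cont: "continuous_on S (\<lambda>\<xi>. (cmod (fourier h \<xi>))\<^sup>2)" for S
    by (intro continuous_intros fourier_continuous_on hi supp)
  \<comment> \<open>A pointwise bound A^2/s^4 on an interval of length 2s gives 2A^2/s^3, better
    than the required s^(-4/3).\<close>
  have "(LINT \<xi>:{-s..s}|lborel. (cmod (fourier h \<xi>))\<^sup>2) \<le> (LINT \<xi>:{-s..s}|lborel. A\<^sup>2 / s ^ 4)"
    by (intro set_integral_mono borel_integrable_atLeastAtMost' cont continuous_on_const bound)
  also have "\<dots> = 2 * A\<^sup>2 * (1 / s ^ 3)"
    using s by (simp add: set_lebesgue_integral_def field_simps eval_nat_numeral)
  also have "1 / s ^ 3 \<le> s powr (- 4 / 3)"
  proof -
    have "s powr (4 / 3) \<le> s powr 3" using s by (intro powr_mono) auto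
    then have "s powr (4 / 3) \<le> s ^ 3" using s by simp
    then have "1 / s ^ 3 \<le> 1 / s powr (4 / 3)" using s by (intro divide_left_mono) auto
    then show ?thesis using powr_minus_divide[of s "4 / 3"] by simp
  qed
  finally show ?thesis by (simp add: mult_left_mono)
qed

section \<open>Gaussian averages of the power spectrum\<close>

text \<open>Cauchy-Schwarz for g against 1 on (x, x+t]. The extended nonnegative form prepares the
  Tonelli exchange that follows.\<close>

lemma primitive_difference_norm_sq:
  fixes g :: "real \<Rightarrow> complex"
  assumes g: "integrable lborel g" and t: "0 \<le> t"
  shows "ennreal ((cmod ((LINT y:{..x + t}|lborel. g y) - (LINT y:{..x}|lborel. g y)))\<^sup>2)
    \<le> ennreal t * (\<integral>\<^sup>+y. ennreal ((cmod (g y))\<^sup>2) * indicator {x<..x + t} y \<partial>lborel)"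
proof -
  have [measurable]: "g \<in> borel_measurable borel" using g by auto
  have int: "set_integrable lborel B g" if "B \<in> sets borel" for B
    using g that by (auto simp: set_integrable_def intro: integrable_mult_indicator)
  have split: "{..x + t} = {..x} \<union> {x<..x + t}" using t by auto
  have "(LINT y:{..x + t}|lborel. g y) - (LINT y:{..x}|lborel. g y) = (LINT y:{x<..x + t}|lborel. g y)"
    unfolding split by (subst set_integral_Un) (auto intro!: int)
  also have "ennreal (cmod \<dots>) \<le> (\<integral>\<^sup>+y. ennreal (norm (indicat_real {x<..x + t} y *\<^sub>R g y)) \<partial>lborel)"
    unfolding set_lebesgue_integral_def by (rule integral_norm_bound_ennreal) (use int[of "{x<..x + t}"] in \<open>simp add: set_integrable_def\<close>)
  also have "\<dots> = (\<integral>\<^sup>+y. ennreal (indicat_real {x<..x + t} y) * ennreal (indicat_real {x<..x + t} y * cmod (g y)) \<partial>lborel)"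
    by (intro nn_integral_cong) (auto simp: indicator_def)
  finally have "(ennreal (cmod ((LINT y:{..x + t}|lborel. g y) - (LINT y:{..x}|lborel. g y))))\<^sup>2
      \<le> (\<integral>\<^sup>+y. ennreal (indicat_real {x<..x + t} y) * ennreal (indicat_real {x<..x + t} y * cmod (g y)) \<partial>lborel)\<^sup>2"
    by (rule power_mono) simp
  also have "\<dots> \<le> (\<integral>\<^sup>+y. (ennreal (indicat_real {x<..x + t} y))\<^sup>2 \<partial>lborel)
      * (\<integral>\<^sup>+y. (ennreal (indicat_real {x<..x + t} y * cmod (g y)))\<^sup>2 \<partial>lborel)"
    by (rule Cauchy_Schwarz_nn_integral) measurable
  also have "(\<integral>\<^sup>+y. (ennreal (indicat_real {x<..x + t} y))\<^sup>2 \<partial>lborel) = (\<integral>\<^sup>+y. indicator {x<..x + t} y \<partial>lborel)"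
    by (intro nn_integral_cong) (auto simp: indicator_def)
  also have "\<dots> = ennreal t" using t by (subst nn_integral_indicator) auto
  also have "(\<integral>\<^sup>+y. (ennreal (indicat_real {x<..x + t} y * cmod (g y)))\<^sup>2 \<partial>lborel)
      = (\<integral>\<^sup>+y. ennreal ((cmod (g y))\<^sup>2) * indicator {x<..x + t} y \<partial>lborel)"
    by (intro nn_integral_cong) (auto simp: indicator_def ennreal_power)
  finally show ?thesis by (simp add: ennreal_power)
qed

text \<open>One factor t comes from Cauchy-Schwarz. After the exchange of integrals, a given y lies
  in (x, x+t] exactly for x in [y-t, y), and the length of that interval is the other factor
  t.\<close>

lemma primitive_translation_bound_nonneg:
  fixes g :: "real \<Rightarrow> complex"
  assumes g: "integrable lborel g" and t: "0 \<le> t"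
  defines "h \<equiv> \<lambda>x. (LINT y:{..x}|lborel. g y)"
  shows "(\<integral>\<^sup>+x. ennreal ((cmod (h (x + t) - h x))\<^sup>2) \<partial>lborel) \<le> ennreal (t\<^sup>2) * (\<integral>\<^sup>+y. ennreal ((cmod (g y))\<^sup>2) \<partial>lborel)"
proof -
  have [measurable]: "g \<in> borel_measurable borel" using g by auto
  have "(\<integral>\<^sup>+x. ennreal ((cmod (h (x + t) - h x))\<^sup>2) \<partial>lborel)
      \<le> (\<integral>\<^sup>+x. ennreal t * (\<integral>\<^sup>+y. ennreal ((cmod (g y))\<^sup>2) * indicator {x<..x + t} y \<partial>lborel) \<partial>lborel)"
    unfolding h_def by (intro nn_integral_mono primitive_difference_norm_sq g t)
  also have "\<dots> = (\<integral>\<^sup>+x. (\<integral>\<^sup>+y. ennreal t * (ennreal ((cmod (g y))\<^sup>2) * (if x < y \<and> y \<le> x + t then 1 else 0)) \<partial>lborel) \<partial>lborel)"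
    by (intro nn_integral_cong, subst nn_integral_cmult[symmetric]) (auto intro!: nn_integral_cong simp: indicator_def)
  also have "\<dots> = (\<integral>\<^sup>+y. (\<integral>\<^sup>+x. ennreal t * (ennreal ((cmod (g y))\<^sup>2) * (if x < y \<and> y \<le> x + t then 1 else 0)) \<partial>lborel) \<partial>lborel)"
    by (rule lborel_pair.Fubini') measurable
  also have "\<dots> = (\<integral>\<^sup>+y. ennreal t * (ennreal ((cmod (g y))\<^sup>2) * ennreal t) \<partial>lborel)"
  proof (intro nn_integral_cong)
    fix y :: real
    have "(\<integral>\<^sup>+x. ennreal t * (ennreal ((cmod (g y))\<^sup>2) * (if x < y \<and> y \<le> x + t then 1 else 0)) \<partial>lborel)
        = (\<integral>\<^sup>+x. (ennreal t * ennreal ((cmod (g y))\<^sup>2)) * indicator {y - t..<y} x \<partial>lborel)"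
      by (intro nn_integral_cong) (auto simp: indicator_def)
    also have "\<dots> = (ennreal t * ennreal ((cmod (g y))\<^sup>2)) * ennreal t"
      using t by (subst nn_integral_cmult_indicator) auto
    finally show "(\<integral>\<^sup>+x. ennreal t * (ennreal ((cmod (g y))\<^sup>2) * (if x < y \<and> y \<le> x + t then 1 else 0)) \<partial>lborel)
        = ennreal t * (ennreal ((cmod (g y))\<^sup>2) * ennreal t)" by (simp add: mult.assoc)
  qed
  also have "\<dots> = (\<integral>\<^sup>+y. ennreal (t\<^sup>2) * ennreal ((cmod (g y))\<^sup>2) \<partial>lborel)"
    using t by (intro nn_integral_cong) (simp add: power2_eq_square ennreal_mult mult_ac)
  also have "\<dots> = ennreal (t\<^sup>2) * (\<integral>\<^sup>+y. ennreal ((cmod (g y))\<^sup>2) \<partial>lborel)"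
    by (rule nn_integral_cmult) measurable
  finally show ?thesis .
qed

lemma primitive_translation_bound:
  fixes g :: "real \<Rightarrow> complex"
  assumes g: "integrable lborel g" and g2: "integrable lborel (\<lambda>y. (cmod (g y))\<^sup>2)"
  defines "h \<equiv> \<lambda>x. (LINT y:{..x}|lborel. g y)"
  shows "(LINT x|lborel. (cmod (h (x + t) - h x))\<^sup>2) \<le> t\<^sup>2 * (LINT y|lborel. (cmod (g y))\<^sup>2)"
proof -
  have [measurable]: "h \<in> borel_measurable borel"
    unfolding h_def using g by (intro primitive_measurable) auto
  have nn: "(\<integral>\<^sup>+x. ennreal ((cmod (h (x + t) - h x))\<^sup>2) \<partial>lborel) \<le> ennreal (t\<^sup>2 * (LINT y|lborel. (cmod (g y))\<^sup>2))"
  proof -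
    have eq: "ennreal (t\<^sup>2 * (LINT y|lborel. (cmod (g y))\<^sup>2)) = ennreal (t\<^sup>2) * (\<integral>\<^sup>+y. ennreal ((cmod (g y))\<^sup>2) \<partial>lborel)"
      by (subst nn_integral_eq_integral[OF g2]) (auto simp: ennreal_mult)
    show ?thesis
    proof (cases "0 \<le> t")
      case True
      then show ?thesis unfolding eq h_def by (rule primitive_translation_bound_nonneg[OF g])
    next
      \<comment> \<open>For negative t, translating x by -t swaps the two points and reduces to the
        shift -t.\<close>
      case False
      have "(\<integral>\<^sup>+x. ennreal ((cmod (h (x + t) - h x))\<^sup>2) \<partial>lborel)
          = (\<integral>\<^sup>+x. ennreal ((cmod (h ((- t + 1 * x) + t) - h (- t + 1 * x)))\<^sup>2) \<partial>lborel)"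
        by (subst nn_integral_real_affine[where c = 1 and t = "- t"]) auto
      also have "\<dots> = (\<integral>\<^sup>+x. ennreal ((cmod (h (x + - t) - h x))\<^sup>2) \<partial>lborel)"
        by (simp add: norm_minus_commute)
      also have "\<dots> \<le> ennreal ((- t)\<^sup>2) * (\<integral>\<^sup>+y. ennreal ((cmod (g y))\<^sup>2) \<partial>lborel)"
        unfolding h_def by (rule primitive_translation_bound_nonneg[OF g]) (use False in simp)
      finally show ?thesis unfolding eq by simp
    qed
  qed
  have "(LINT x|lborel. (cmod (h (x + t) - h x))\<^sup>2) = enn2real (\<integral>\<^sup>+x. ennreal ((cmod (h (x + t) - h x))\<^sup>2) \<partial>lborel)"
    by (rule integral_eq_nn_integral) auto
  also have "\<dots> \<le> t\<^sup>2 * (LINT y|lborel. (cmod (g y))\<^sup>2)"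
    by (rule enn2real_leI[OF _ nn]) simp
  finally show ?thesis .
qed

section \<open>The autocorrelation and its Fourier transform\<close>

lemma bounded_support_integrable:
  fixes h :: "real \<Rightarrow> 'a :: {banach, second_countable_topology}"
  assumes "h \<in> borel_measurable borel" "\<And>x. norm (h x) \<le> B" "\<And>x. R < \<bar>x\<bar> \<Longrightarrow> h x = 0"
  shows "integrable lborel h"
  by (rule integrableI_bounded_set[where A = "{- R..R}" and B = B])
     (use assms in \<open>auto intro!: AE_I2 simp: emeasure_lborel_Icc_eq\<close>)

lemma borel_measurable_cnj [measurable]: "cnj \<in> borel_measurable borel"
  by (intro borel_measurable_continuous_onI continuous_on_cnj continuous_on_id)

definition autocorrelation :: "(real \<Rightarrow> complex) \<Rightarrow> real \<Rightarrow> complex" where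
  "autocorrelation h t = (LINT x|lborel. h (x + t) * cnj (h x))"

lemma autocorrelation_integrable:
  assumes [measurable]: "h \<in> borel_measurable borel" and B: "\<And>x. cmod (h x) \<le> B"
    and supp: "\<And>x. 1 < \<bar>x\<bar> \<Longrightarrow> h x = 0"
  shows "integrable lborel (autocorrelation h)"
proof (rule bounded_support_integrable[where R = 2])
  have hi: "integrable lborel (\<lambda>x. cnj (h x))"
    by (rule bounded_support_integrable[where B = B and R = 1]) (use B supp in auto)
  show "autocorrelation h \<in> borel_measurable borel"
    unfolding autocorrelation_def[abs_def] by measurable
  show "norm (autocorrelation h t) \<le> B * (LINT x|lborel. cmod (cnj (h x)))" for t
    unfolding autocorrelation_def
    by (rule integrable_bounded_mult(2)[OF hi]) (use B in auto)
  show "autocorrelation h t = 0" if "2 < \<bar>t\<bar>" for t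
  proof -
    have "h (x + t) * cnj (h x) = 0" for x
      using supp[of x] supp[of "x + t"] that by (cases "1 < \<bar>x\<bar>") auto
    then show ?thesis unfolding autocorrelation_def by (simp only: integral_zero)
  qed
qed

lemma Re_autocorrelation_ge:
  assumes [measurable]: "h \<in> borel_measurable borel" and B: "\<And>x. cmod (h x) \<le> B"
    and supp: "\<And>x. 1 < \<bar>x\<bar> \<Longrightarrow> h x = 0"
    and mod: "(LINT x|lborel. (cmod (h (x + t) - h x))\<^sup>2) \<le> t\<^sup>2 * Q"
  shows "(LINT x|lborel. (cmod (h x))\<^sup>2) - t\<^sup>2 / 2 * Q \<le> Re (autocorrelation h t)"
proof -
  have B0: "0 \<le> B" using B[of 0] norm_ge_zero order_trans by blast
  have int0: "integrable lborel (\<lambda>x. (cmod (h x))\<^sup>2)"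
    by (rule bounded_support_integrable[where B = "B\<^sup>2" and R = 1]) (use B supp in \<open>auto intro!: power_mono\<close>)
  have int1: "integrable lborel (\<lambda>x. (cmod (h (x + t)))\<^sup>2)"
    using lborel_integrable_real_affine[OF int0, of 1 t] by (simp add: add.commute)
  have eq1: "(LINT x|lborel. (cmod (h (x + t)))\<^sup>2) = (LINT x|lborel. (cmod (h x))\<^sup>2)"
    using lborel_integral_real_affine[of 1 "\<lambda>x. (cmod (h x))\<^sup>2" t] by (simp add: add.commute)
  have int2: "integrable lborel (\<lambda>x. (cmod (h (x + t) - h x))\<^sup>2)"
  proof (rule bounded_support_integrable[where B = "(2 * B)\<^sup>2" and R = "1 + \<bar>t\<bar>"])
    show "norm ((cmod (h (x + t) - h x))\<^sup>2) \<le> (2 * B)\<^sup>2" for x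
    proof -
      have "cmod (h (x + t) - h x) \<le> 2 * B"
        using norm_triangle_ineq4[of "h (x + t)" "h x"] B[of x] B[of "x + t"] by linarith
      then have "(cmod (h (x + t) - h x))\<^sup>2 \<le> (2 * B)\<^sup>2" by (rule power_mono) simp
      then show ?thesis by simp
    qed
    show "(cmod (h (x + t) - h x))\<^sup>2 = 0" if "1 + \<bar>t\<bar> < \<bar>x\<bar>" for x
      using supp[of x] supp[of "x + t"] that by auto
  qed measurable
  have int3: "integrable lborel (\<lambda>x. h (x + t) * cnj (h x))"
  proof (rule bounded_support_integrable[where B = "B * B" and R = 1])
    show "norm (h (x + t) * cnj (h x)) \<le> B * B" for x
      using B B0 by (auto simp: norm_mult intro!: mult_mono)
  qed (use supp in auto)
  have polar: "Re (z * cnj w) = ((cmod z)\<^sup>2 + (cmod w)\<^sup>2 - (cmod (z - w))\<^sup>2) / 2" for z w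
    unfolding cmod_power2 by (simp add: power2_eq_square algebra_simps)
  have "Re (autocorrelation h t) = (LINT x|lborel. Re (h (x + t) * cnj (h x)))"
    unfolding autocorrelation_def by (rule integral_Re[OF int3, symmetric])
  also have "\<dots> = ((LINT x|lborel. (cmod (h x))\<^sup>2) + (LINT x|lborel. (cmod (h x))\<^sup>2)
      - (LINT x|lborel. (cmod (h (x + t) - h x))\<^sup>2)) / 2"
    unfolding polar using int0 int1 int2 by (simp add: eq1)
  finally show ?thesis using mod by simp
qed

text \<open>The Wiener-Khinchin identity: write |F|^2 as the product of F and its conjugate,
  substitute y = x + t in F, and exchange the integrals. The phases in x cancel, leaving exp(-i
  \<xi> t).\<close>

lemma fourier_norm_sq_eq:
  assumes [measurable]: "h \<in> borel_measurable borel" and B: "\<And>x. cmod (h x) \<le> B"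
    and supp: "\<And>x. 1 < \<bar>x\<bar> \<Longrightarrow> h x = 0"
  shows "complex_of_real ((cmod (fourier h \<xi>))\<^sup>2) = (LINT t|lborel. iexp (- (\<xi> * t)) * autocorrelation h t)"
proof -
  have B0: "0 \<le> B" using B[of 0] norm_ge_zero order_trans by blast
  define k where "k t x = iexp (- (\<xi> * t)) * (h (x + t) * cnj (h x))" for t x
  have kint: "integrable (lborel \<Otimes>\<^sub>M lborel) (\<lambda>(t, x). k t x)"
  proof (rule Bochner_Integration.integrable_bound)
    show "integrable (lborel \<Otimes>\<^sub>M lborel) (\<lambda>(t :: real, x :: real). indicat_real {-2..2} t * (B * B * indicat_real {-1..1} x))"
      by (rule integrable_product_lborel) auto
    show "(\<lambda>(t, x). k t x) \<in> borel_measurable (lborel \<Otimes>\<^sub>M lborel)"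
      unfolding k_def by measurable
    have "norm (k t x) \<le> indicat_real {-2..2} t * (B * B * indicat_real {-1..1} x)" for t x
    proof (cases "\<bar>x\<bar> \<le> 1 \<and> \<bar>t\<bar> \<le> 2")
      case True
      have "norm (k t x) = cmod (h (x + t)) * cmod (h x)" by (simp add: k_def norm_mult)
      also have "\<dots> \<le> B * B" using B B0 by (intro mult_mono) auto
      finally show ?thesis using True by (simp add: indicator_def abs_le_iff)
    next
      case False
      then have "1 < \<bar>x\<bar> \<or> 1 < \<bar>x + t\<bar>" by linarith
      then have "k t x = 0" using supp by (auto simp: k_def)
      then show ?thesis using B0 by simp
    qed
    then show "AE p in lborel \<Otimes>\<^sub>M lborel. norm (case p of (t, x) \<Rightarrow> k t x)
        \<le> norm (case p of (t :: real, x :: real) \<Rightarrow> indicat_real {-2..2} t * (B * B * indicat_real {-1..1} x))"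
      using B0 by (auto intro!: AE_I2 simp: abs_mult)
  qed
  have "(LINT t|lborel. iexp (- (\<xi> * t)) * autocorrelation h t) = (LINT t|lborel. LINT x|lborel. k t x)"
    unfolding k_def autocorrelation_def by (simp only: integral_mult_right_zero)
  also have "\<dots> = (LINT x|lborel. LINT t|lborel. k t x)"
    by (rule lborel_pair.Fubini_integral[OF kint, symmetric])
  also have "\<dots> = (LINT x|lborel. cnj (iexp (- (\<xi> * x)) * h x) * fourier h \<xi>)"
  proof (rule Bochner_Integration.integral_cong[OF refl])
    fix x
    have "fourier h \<xi> = (LINT t|lborel. iexp (- (\<xi> * (x + t))) * h (x + t))"
      unfolding fourier_def
      using lborel_integral_real_affine[of 1 "\<lambda>y. iexp (- (\<xi> * y)) * h y" x] by simp
    then have "cnj (iexp (- (\<xi> * x)) * h x) * fourier h \<xi>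
        = (LINT t|lborel. cnj (iexp (- (\<xi> * x)) * h x) * (iexp (- (\<xi> * (x + t))) * h (x + t)))"
      by (simp only: integral_mult_right_zero)
    also have "\<dots> = (LINT t|lborel. k t x)"
    proof (rule Bochner_Integration.integral_cong[OF refl])
      fix t
      have "cnj (iexp (- (\<xi> * x))) * iexp (- (\<xi> * (x + t))) = iexp (- (\<xi> * t))"
        by (simp add: exp_cnj exp_add[symmetric] algebra_simps)
      then show "cnj (iexp (- (\<xi> * x)) * h x) * (iexp (- (\<xi> * (x + t))) * h (x + t)) = k t x"
        unfolding k_def complex_cnj_mult by (metis mult.assoc mult.commute)
    qed
    finally show "(LINT t|lborel. k t x) = cnj (iexp (- (\<xi> * x)) * h x) * fourier h \<xi>" by simp
  qed
  also have "\<dots> = cnj (fourier h \<xi>) * fourier h \<xi>"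
    by (subst integral_mult_left_zero) (simp only: Bochner_Integration.integral_cnj fourier_def)
  also have "\<dots> = complex_of_real ((cmod (fourier h \<xi>))\<^sup>2)"
    by (simp only: complex_norm_square mult.commute)
  finally show ?thesis by simp
qed

text \<open>After Fubini the inner z-integral is the characteristic function of the standard normal
  at -t/\<sigma>, again a Gaussian.\<close>

lemma gaussian_average_fourier:
  assumes hm [measurable]: "h \<in> borel_measurable borel" and B: "\<And>x. cmod (h x) \<le> B"
    and supp: "\<And>x. 1 < \<bar>x\<bar> \<Longrightarrow> h x = 0"
  shows "(LINT z|lborel. std_normal_density z * (cmod (fourier h (z / \<sigma>)))\<^sup>2)
    = (LINT t|lborel. exp (- (t / \<sigma>)\<^sup>2 / 2) * Re (autocorrelation h t))"
proof -
  define c where "c = autocorrelation h"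
  have ci: "integrable lborel c" unfolding c_def by (rule autocorrelation_integrable[OF assms])
  have [measurable]: "c \<in> borel_measurable borel" using ci by auto
  define k where "k z t = std_normal_density z *\<^sub>R (iexp (- (z / \<sigma> * t)) * c t)" for z t
  have kint: "integrable (lborel \<Otimes>\<^sub>M lborel) (\<lambda>(z, t). k z t)"
  proof (rule Bochner_Integration.integrable_bound)
    show "integrable (lborel \<Otimes>\<^sub>M lborel) (\<lambda>(z, t). std_normal_density z * cmod (c t))"
      by (rule integrable_product_lborel) (use ci in auto)
    show "(\<lambda>(z, t). k z t) \<in> borel_measurable (lborel \<Otimes>\<^sub>M lborel)"
      unfolding k_def by measurable
    show "AE p in lborel \<Otimes>\<^sub>M lborel. norm (case p of (z, t) \<Rightarrow> k z t)
        \<le> norm (case p of (z, t) \<Rightarrow> std_normal_density z * cmod (c t))"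
      by (auto intro!: AE_I2 simp: k_def norm_mult abs_mult)
  qed
  have "complex_of_real (LINT z|lborel. std_normal_density z * (cmod (fourier h (z / \<sigma>)))\<^sup>2)
      = (LINT z|lborel. std_normal_density z *\<^sub>R complex_of_real ((cmod (fourier h (z / \<sigma>)))\<^sup>2))"
    by (subst integral_complex_of_real[symmetric]) (simp add: scaleR_conv_of_real)
  also have "\<dots> = (LINT z|lborel. LINT t|lborel. k z t)"
    by (intro Bochner_Integration.integral_cong refl)
      (simp only: fourier_norm_sq_eq[OF assms] k_def c_def integral_scaleR_right)
  also have "\<dots> = (LINT t|lborel. LINT z|lborel. k z t)"
    by (rule lborel_pair.Fubini_integral[OF kint, symmetric])
  also have "\<dots> = (LINT t|lborel. complex_of_real (exp (- (t / \<sigma>)\<^sup>2 / 2)) * c t)"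
  proof (rule Bochner_Integration.integral_cong[OF refl])
    fix t
    have "(LINT z|lborel. k z t) = (LINT z|lborel. (std_normal_density z *\<^sub>R iexp (- (t / \<sigma>) * z)) * c t)"
      by (intro Bochner_Integration.integral_cong) (auto simp: k_def mult_ac)
    also have "\<dots> = (LINT z|lborel. std_normal_density z *\<^sub>R iexp (- (t / \<sigma>) * z)) * c t"
      by (rule integral_mult_left_zero)
    also have "(LINT z|lborel. std_normal_density z *\<^sub>R iexp (- (t / \<sigma>) * z)) = char std_normal_distribution (- (t / \<sigma>))"
      unfolding char_def by (subst integral_density) auto
    also have "\<dots> = complex_of_real (exp (- (t / \<sigma>)\<^sup>2 / 2))"
      unfolding char_std_normal_distribution by simp
    finally show "(LINT z|lborel. k z t) = complex_of_real (exp (- (t / \<sigma>)\<^sup>2 / 2)) * c t" .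
  qed
  finally have eq: "complex_of_real (LINT z|lborel. std_normal_density z * (cmod (fourier h (z / \<sigma>)))\<^sup>2)
      = (LINT t|lborel. complex_of_real (exp (- (t / \<sigma>)\<^sup>2 / 2)) * c t)" .
  have int: "integrable lborel (\<lambda>t. complex_of_real (exp (- (t / \<sigma>)\<^sup>2 / 2)) * c t)"
    by (rule integrable_bounded_mult(1)[OF ci, where B = 1]) auto
  show ?thesis
    using arg_cong[OF eq, of Re] unfolding integral_Re[OF int, symmetric] by (simp add: c_def)
qed

text \<open>The weight is \<sigma> sqrt(2 pi) times the normal density of deviation \<sigma>, so
  only its mass and variance enter. The quadratic lower bound for Re c holds for all t, even where
  it is negative, so the integral needs no truncation.\<close>

lemma gaussian_average_fourier_ge:
  assumes hm [measurable]: "h \<in> borel_measurable borel" and B: "\<And>x. cmod (h x) \<le> B"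
    and supp: "\<And>x. 1 < \<bar>x\<bar> \<Longrightarrow> h x = 0" and \<sigma>: "0 < \<sigma>"
    and mod: "\<And>t. (LINT x|lborel. (cmod (h (x + t) - h x))\<^sup>2) \<le> t\<^sup>2 * Q"
  shows "\<sigma> * sqrt (2 * pi) * ((LINT x|lborel. (cmod (h x))\<^sup>2) - \<sigma>\<^sup>2 / 2 * Q)
    \<le> (LINT z|lborel. std_normal_density z * (cmod (fourier h (z / \<sigma>)))\<^sup>2)"
proof -
  define H where "H = (LINT x|lborel. (cmod (h x))\<^sup>2)"
  have gauss: "exp (- (t / \<sigma>)\<^sup>2 / 2) = \<sigma> * sqrt (2 * pi) * normal_density 0 \<sigma> t" for t
    using \<sigma> by (simp add: normal_density_def real_sqrt_mult power_divide field_simps)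
  have m0: "has_bochner_integral lborel (\<lambda>t. normal_density 0 \<sigma> t * 1) 1"
    using normal_moment_even[OF \<sigma>, of 0 0] by simp
  have m2: "has_bochner_integral lborel (\<lambda>t. normal_density 0 \<sigma> t * t\<^sup>2) (\<sigma>\<^sup>2)"
    using normal_moment_even[OF \<sigma>, of 0 1] \<sigma> by (simp add: fact_numeral)
  have low: "has_bochner_integral lborel
      (\<lambda>t. \<sigma> * sqrt (2 * pi) * (normal_density 0 \<sigma> t * 1 * H - normal_density 0 \<sigma> t * t\<^sup>2 * (Q / 2)))
      (\<sigma> * sqrt (2 * pi) * (1 * H - \<sigma>\<^sup>2 * (Q / 2)))"
    by (intro has_bochner_integral_mult_right has_bochner_integral_diff has_bochner_integral_mult_left m0 m2)
  have "\<sigma> * sqrt (2 * pi) * (1 * H - \<sigma>\<^sup>2 * (Q / 2))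
      = (LINT t|lborel. \<sigma> * sqrt (2 * pi) * (normal_density 0 \<sigma> t * 1 * H - normal_density 0 \<sigma> t * t\<^sup>2 * (Q / 2)))"
    by (rule has_bochner_integral_integral_eq[OF low, symmetric])
  also have "\<dots> \<le> (LINT t|lborel. exp (- (t / \<sigma>)\<^sup>2 / 2) * Re (autocorrelation h t))"
  proof (rule integral_mono)
    show "integrable lborel (\<lambda>t. \<sigma> * sqrt (2 * pi) * (normal_density 0 \<sigma> t * 1 * H - normal_density 0 \<sigma> t * t\<^sup>2 * (Q / 2)))"
      using low by (rule integrable.intros)
    have "integrable lborel (\<lambda>t. complex_of_real (exp (- (t / \<sigma>)\<^sup>2 / 2)) * autocorrelation h t)"
      by (rule integrable_bounded_mult(1)[OF autocorrelation_integrable[OF hm B supp], where B = 1]) auto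
    then show "integrable lborel (\<lambda>t. exp (- (t / \<sigma>)\<^sup>2 / 2) * Re (autocorrelation h t))"
      using integrable_Re by fastforce
    fix t
    have "\<sigma> * sqrt (2 * pi) * (normal_density 0 \<sigma> t * 1 * H - normal_density 0 \<sigma> t * t\<^sup>2 * (Q / 2))
        = exp (- (t / \<sigma>)\<^sup>2 / 2) * (H - t\<^sup>2 / 2 * Q)"
      unfolding gauss by (simp add: algebra_simps)
    also have "\<dots> \<le> exp (- (t / \<sigma>)\<^sup>2 / 2) * Re (autocorrelation h t)"
      unfolding H_def by (intro mult_left_mono Re_autocorrelation_ge[OF hm B supp mod]) auto
    finally show "\<sigma> * sqrt (2 * pi) * (normal_density 0 \<sigma> t * 1 * H - normal_density 0 \<sigma> t * t\<^sup>2 * (Q / 2))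
        \<le> exp (- (t / \<sigma>)\<^sup>2 / 2) * Re (autocorrelation h t)" .
  qed
  also have "\<dots> = (LINT z|lborel. std_normal_density z * (cmod (fourier h (z / \<sigma>)))\<^sup>2)"
    by (rule gaussian_average_fourier[OF hm B supp, symmetric])
  finally show ?thesis by (simp add: H_def)
qed

text \<open>Split at |z| = \<sigma> s. Inside, the density is at most 1/sqrt(2 pi), and z = \<sigma>
  \<xi> yields the factor \<sigma>. Outside, 1 \<le> (z/(\<sigma> s))^6 as in Chebyshev's
  inequality, with |F|^2 \<le> A^2.\<close>

lemma gaussian_average_fourier_le:
  assumes h: "integrable lborel h" and supp: "\<And>x. 1 < \<bar>x\<bar> \<Longrightarrow> h x = 0"
    and A: "(LINT y|lborel. cmod (h y)) \<le> A" and \<sigma>: "0 < \<sigma>" and s: "0 < s"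
  shows "(LINT z|lborel. std_normal_density z * (cmod (fourier h (z / \<sigma>)))\<^sup>2)
    \<le> \<sigma> / sqrt (2 * pi) * (LINT \<xi>:{-s..s}|lborel. (cmod (fourier h \<xi>))\<^sup>2) + 15 * A\<^sup>2 / (\<sigma> * s) ^ 6"
proof -
  have bound: "(cmod (fourier h \<xi>))\<^sup>2 \<le> A\<^sup>2" for \<xi>
    using fourier_bound[OF h, of \<xi>] A by (intro power_mono) auto
  have cont: "continuous_on S (\<lambda>\<xi>. (cmod (fourier h \<xi>))\<^sup>2)" for S
    by (intro continuous_intros fourier_continuous_on h supp)
  have [measurable]: "(\<lambda>\<xi>. (cmod (fourier h \<xi>))\<^sup>2) \<in> borel_measurable borel"
    by (intro borel_measurable_continuous_onI cont)
  define J where "J = (LINT \<xi>:{-s..s}|lborel. (cmod (fourier h \<xi>))\<^sup>2)"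
  have low_int: "integrable lborel (\<lambda>\<xi>. indicat_real {-s..s} \<xi> * (cmod (fourier h \<xi>))\<^sup>2)"
    using borel_integrable_compact[OF compact_Icc cont, of "-s" s] by simp
  have scaled_int: "integrable lborel (\<lambda>z. indicat_real {-s..s} (z / \<sigma>) * (cmod (fourier h (z / \<sigma>)))\<^sup>2)"
    using lborel_integrable_real_affine[OF low_int, of "1 / \<sigma>" 0] \<sigma> by simp
  have scaled: "(LINT z|lborel. indicat_real {-s..s} (z / \<sigma>) * (cmod (fourier h (z / \<sigma>)))\<^sup>2) = \<sigma> * J"
    using lborel_integral_real_affine[of "1 / \<sigma>" "\<lambda>\<xi>. indicat_real {-s..s} \<xi> * (cmod (fourier h \<xi>))\<^sup>2" 0] \<sigma>
    by (simp add: J_def set_lebesgue_integral_def)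
  \<comment> \<open>15 = 1 * 3 * 5 is the sixth moment of the standard normal distribution.\<close>
  have m6: "has_bochner_integral lborel (\<lambda>z. std_normal_density z * z ^ 6) 15"
    using std_normal_moment_even[of 3] by (simp add: fact_numeral)
  have std_le: "std_normal_density z \<le> 1 / sqrt (2 * pi)" for z
    by (simp add: std_normal_density_def divide_right_mono)
  have majorant: "has_bochner_integral lborel
     (\<lambda>z. 1 / sqrt (2 * pi) * (indicat_real {-s..s} (z / \<sigma>) * (cmod (fourier h (z / \<sigma>)))\<^sup>2)
        + A\<^sup>2 / (\<sigma> * s) ^ 6 * (std_normal_density z * z ^ 6))
     (1 / sqrt (2 * pi) * (\<sigma> * J) + A\<^sup>2 / (\<sigma> * s) ^ 6 * 15)"
    by (intro has_bochner_integral_add has_bochner_integral_mult_right m6)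
      (use scaled_int scaled in \<open>simp add: has_bochner_integral_iff\<close>)
  have "(LINT z|lborel. std_normal_density z * (cmod (fourier h (z / \<sigma>)))\<^sup>2)
     \<le> (LINT z|lborel. 1 / sqrt (2 * pi) * (indicat_real {-s..s} (z / \<sigma>) * (cmod (fourier h (z / \<sigma>)))\<^sup>2)
        + A\<^sup>2 / (\<sigma> * s) ^ 6 * (std_normal_density z * z ^ 6))"
  proof (rule integral_mono)
    show "integrable lborel (\<lambda>z. std_normal_density z * (cmod (fourier h (z / \<sigma>)))\<^sup>2)"
    proof (rule Bochner_Integration.integrable_bound)
      show "integrable lborel (\<lambda>z. std_normal_density z * A\<^sup>2)" by simp
      show "AE z in lborel. norm (std_normal_density z * (cmod (fourier h (z / \<sigma>)))\<^sup>2) \<le> norm (std_normal_density z * A\<^sup>2)"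
        using bound by (auto intro!: AE_I2 mult_left_mono simp: abs_mult)
    qed measurable
    show "integrable lborel (\<lambda>z. 1 / sqrt (2 * pi) * (indicat_real {-s..s} (z / \<sigma>) * (cmod (fourier h (z / \<sigma>)))\<^sup>2)
        + A\<^sup>2 / (\<sigma> * s) ^ 6 * (std_normal_density z * z ^ 6))"
      using majorant by (rule integrable.intros)
    fix z :: real
    have even6: "0 \<le> z ^ 6" for z :: real by simp
    show "std_normal_density z * (cmod (fourier h (z / \<sigma>)))\<^sup>2
      \<le> 1 / sqrt (2 * pi) * (indicat_real {-s..s} (z / \<sigma>) * (cmod (fourier h (z / \<sigma>)))\<^sup>2)
        + A\<^sup>2 / (\<sigma> * s) ^ 6 * (std_normal_density z * z ^ 6)"
    proof (cases "\<bar>z\<bar> \<le> \<sigma> * s")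
      case True
      then have "z / \<sigma> \<in> {-s..s}" using \<sigma> by (auto simp: field_simps abs_le_iff)
      then have "1 / sqrt (2 * pi) * (indicat_real {-s..s} (z / \<sigma>) * (cmod (fourier h (z / \<sigma>)))\<^sup>2)
          = 1 / sqrt (2 * pi) * (cmod (fourier h (z / \<sigma>)))\<^sup>2" by simp
      moreover have "std_normal_density z * (cmod (fourier h (z / \<sigma>)))\<^sup>2 \<le> 1 / sqrt (2 * pi) * (cmod (fourier h (z / \<sigma>)))\<^sup>2"
        by (intro mult_right_mono std_le) auto
      moreover have "0 \<le> A\<^sup>2 / (\<sigma> * s) ^ 6 * (std_normal_density z * z ^ 6)"
        by (intro mult_nonneg_nonneg divide_nonneg_nonneg even6 normal_density_nonneg) simp
      ultimately show ?thesis by linarith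
    next
      case False
      then have "(\<sigma> * s) ^ 6 \<le> \<bar>z\<bar> ^ 6" using \<sigma> s by (intro power_mono) auto
      then have "1 \<le> z ^ 6 / (\<sigma> * s) ^ 6" using \<sigma> s by (simp add: power_even_abs)
      then have "A\<^sup>2 * 1 \<le> A\<^sup>2 * (z ^ 6 / (\<sigma> * s) ^ 6)" by (intro mult_left_mono) auto
      then have "(cmod (fourier h (z / \<sigma>)))\<^sup>2 \<le> A\<^sup>2 * (z ^ 6 / (\<sigma> * s) ^ 6)"
        using bound[of "z / \<sigma>"] by linarith
      then have "std_normal_density z * (cmod (fourier h (z / \<sigma>)))\<^sup>2 \<le> std_normal_density z * (A\<^sup>2 * (z ^ 6 / (\<sigma> * s) ^ 6))"
        by (intro mult_left_mono) auto
      also have "\<dots> = A\<^sup>2 / (\<sigma> * s) ^ 6 * (std_normal_density z * z ^ 6)" by simp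
      moreover have "0 \<le> 1 / sqrt (2 * pi) * (indicat_real {-s..s} (z / \<sigma>) * (cmod (fourier h (z / \<sigma>)))\<^sup>2)"
        by simp
      ultimately show ?thesis by linarith
    qed
  qed
  also have "\<dots> = 1 / sqrt (2 * pi) * (\<sigma> * J) + A\<^sup>2 / (\<sigma> * s) ^ 6 * 15"
    by (rule has_bochner_integral_integral_eq[OF majorant])
  finally show ?thesis by (simp add: J_def mult.commute)
qed

lemma L2_norm_le_low_frequencies:
  assumes hm: "h \<in> borel_measurable borel" and B: "\<And>x. cmod (h x) \<le> B"
    and supp: "\<And>x. 1 < \<bar>x\<bar> \<Longrightarrow> h x = 0"
    and mod: "\<And>t. (LINT x|lborel. (cmod (h (x + t) - h x))\<^sup>2) \<le> t\<^sup>2 * Q"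
    and A: "(LINT y|lborel. cmod (h y)) \<le> A" and s: "0 < s"
  shows "(LINT x|lborel. (cmod (h x))\<^sup>2)
    \<le> (LINT \<xi>:{-s..s}|lborel. (cmod (fourier h \<xi>))\<^sup>2) / (2 * pi) + (15 * A\<^sup>2 / sqrt (2 * pi) + Q / 2) * s powr (- 4 / 3)"
proof -
  \<comment> \<open>After division by \<sigma> sqrt(2 pi) the errors have sizes \<sigma>^2 and
    1/(\<sigma> (\<sigma> s)^6). They balance when \<sigma>^9 = s^(-6), and both are then s^(-4/3);
    this is why the sixth moment is the one used.\<close>
  define \<sigma> where "\<sigma> = s powr (- 2 / 3)"
  have \<sigma>: "0 < \<sigma>" using s by (simp add: \<sigma>_def)
  have \<sigma>2: "\<sigma>\<^sup>2 = s powr (- 4 / 3)"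
    using s by (simp add: \<sigma>_def power2_eq_square powr_add[symmetric])
  have tail: "1 / (\<sigma> * (\<sigma> * s) ^ 6) = s powr (- 4 / 3)"
  proof -
    have "\<sigma> * s = s powr (1 / 3)" using s powr_add[of s "- 2 / 3" 1] by (simp add: \<sigma>_def)
    then have "(\<sigma> * s) ^ 6 = s powr (1 / 3 * 6)" using s by (simp add: powr_power)
    then have "\<sigma> * (\<sigma> * s) ^ 6 = s powr (4 / 3)" by (simp add: \<sigma>_def powr_add[symmetric])
    then show ?thesis using powr_minus_divide[of s "4 / 3"] by simp
  qed
  define H J where "H = (LINT x|lborel. (cmod (h x))\<^sup>2)" and "J = (LINT \<xi>:{-s..s}|lborel. (cmod (fourier h \<xi>))\<^sup>2)"
  have hi: "integrable lborel h"
    by (rule bounded_support_integrable[where B = B and R = 1]) (use hm B supp in auto)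
  have "\<sigma> * sqrt (2 * pi) * (H - \<sigma>\<^sup>2 / 2 * Q) \<le> \<sigma> / sqrt (2 * pi) * J + 15 * A\<^sup>2 / (\<sigma> * s) ^ 6"
    unfolding H_def J_def
    by (rule order_trans[OF gaussian_average_fourier_ge[OF hm B supp \<sigma> mod] gaussian_average_fourier_le[OF hi supp A \<sigma> s]])
  also have "\<dots> = \<sigma> * sqrt (2 * pi) * (J / (2 * pi) + 15 * A\<^sup>2 / sqrt (2 * pi) * (1 / (\<sigma> * (\<sigma> * s) ^ 6)))"
  proof -
    have "sqrt (2 * pi) * J / (2 * pi) = J / sqrt (2 * pi)"
      using real_div_sqrt[of "2 * pi"] real_sqrt_mult_self[of "2 * pi"] pi_gt_zero
      by (simp add: field_simps)
    then show ?thesis using \<sigma> s by (simp add: field_simps)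
  qed
  finally have "H - \<sigma>\<^sup>2 / 2 * Q \<le> J / (2 * pi) + 15 * A\<^sup>2 / sqrt (2 * pi) * (1 / (\<sigma> * (\<sigma> * s) ^ 6))"
    using \<sigma> by (subst (asm) mult_le_cancel_left_pos) (auto intro!: mult_pos_pos)
  then show ?thesis unfolding tail \<sigma>2 H_def J_def by (simp add: algebra_simps)
qed

section \<open>Boundary data and the stability estimate\<close>

lemma integral_symmetric_interval:
  fixes \<phi> :: "real \<Rightarrow> real"
  assumes "continuous_on UNIV \<phi>" "0 \<le> K"
  shows "(LINT x:{-K..K}|lborel. \<phi> x) = (LINT x:{0..K}|lborel. \<phi> x + \<phi> (- x))"
proof -
  have int: "set_integrable lborel {a..b} \<phi>" for a b
    using assms(1) by (intro borel_integrable_atLeastAtMost' continuous_on_subset[OF assms(1)]) auto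
  have int': "set_integrable lborel {0..K} (\<lambda>x. \<phi> (- x))"
    by (intro borel_integrable_atLeastAtMost' continuous_intros continuous_on_compose2[OF assms(1)]) auto
  have "{-K..K} = {-K..0} \<union> {0..K}" using assms(2) by auto
  then have "(LINT x:{-K..K}|lborel. \<phi> x) = (LINT x:{-K..0} \<union> {0..K}|lborel. \<phi> x)" by simp
  also have "\<dots> = (LINT x:{-K..0}|lborel. \<phi> x) + (LINT x:{0..K}|lborel. \<phi> x)"
  proof (rule set_integral_Un_AE)
    have "AE x in lborel. x \<noteq> (0::real)" by (rule AE_lborel_singleton)
    then show "AE x in lborel. \<not> (x \<in> {-K..0} \<and> x \<in> {0..K})" by eventually_elim auto
  qed (use int in \<open>auto simp: set_integrable_def\<close>)
  also have "(LINT x:{-K..0}|lborel. \<phi> x) = (LINT x:{0..K}|lborel. \<phi> (- x))"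
    unfolding set_lebesgue_integral_def
    by (subst lborel_integral_real_affine[where c = "-1" and t = 0])
       (auto intro!: Bochner_Integration.integral_cong simp: indicator_def)
  finally show ?thesis using int int' by (simp add: set_integral_add)
qed

text \<open>Seen from an endpoint \<tau> = 1 or \<tau> = -1, the distance |\<tau> - y| equals 1 -
  \<tau> y on all of [-1,1], so the Green kernel is a single plane wave in y.\<close>

lemma wave_field_eq_fourier:
  assumes hm: "h \<in> borel_measurable borel" and supp: "\<And>y. 1 < \<bar>y\<bar> \<Longrightarrow> h y = 0"
    and fm: "(\<lambda>y. indicat_real {-1..1} y *\<^sub>R f y) \<in> borel_measurable borel"
    and ae: "AE y in lborel. f y = h y"
  shows "wave_field f 1 \<omega> = \<i> * iexp \<omega> / complex_of_real (2 * \<omega>) * fourier h \<omega>"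
    and "wave_field f (-1) \<omega> = \<i> * iexp \<omega> / complex_of_real (2 * \<omega>) * fourier h (- \<omega>)"
proof -
  have general: "wave_field f \<tau> \<omega> = \<i> * iexp \<omega> / complex_of_real (2 * \<omega>) * fourier h (\<tau> * \<omega>)"
    if \<tau>: "\<tau> = 1 \<or> \<tau> = -1" for \<tau>
  proof -
    have [measurable]: "h \<in> borel_measurable borel" by fact
    have [measurable]: "(\<lambda>y. indicat_real {-1..1} y *\<^sub>R f y) \<in> borel_measurable borel" by fact
    have "wave_field f \<tau> \<omega> = (LINT y|lborel. \<i> * exp (\<i> * complex_of_real (\<omega> * \<bar>\<tau> - y\<bar>)) / complex_of_real (2 * \<omega>)
        * (indicat_real {-1..1} y *\<^sub>R f y))"
      unfolding wave_field_def set_lebesgue_integral_def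
      by (intro Bochner_Integration.integral_cong) auto
    also have "\<dots> = (LINT y|lborel. \<i> * iexp \<omega> / complex_of_real (2 * \<omega>) * (iexp (- (\<tau> * \<omega> * y)) * h y))"
    proof (rule integral_cong_AE)
      show "AE y in lborel. \<i> * exp (\<i> * complex_of_real (\<omega> * \<bar>\<tau> - y\<bar>)) / complex_of_real (2 * \<omega>)
          * (indicat_real {-1..1} y *\<^sub>R f y)
          = \<i> * iexp \<omega> / complex_of_real (2 * \<omega>) * (iexp (- (\<tau> * \<omega> * y)) * h y)"
        using ae
      proof eventually_elim
        case (elim y)
        show ?case
        proof (cases "y \<in> {-1..1}")
          case True
          then have "\<bar>\<tau> - y\<bar> = 1 - \<tau> * y" using \<tau> by auto
          then have "\<omega> * \<bar>\<tau> - y\<bar> = \<omega> + - (\<tau> * \<omega> * y)"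
            by (simp only: right_diff_distrib) simp
          then have "exp (\<i> * complex_of_real (\<omega> * \<bar>\<tau> - y\<bar>)) = iexp \<omega> * iexp (- (\<tau> * \<omega> * y))"
            by (simp only: of_real_add distrib_left exp_add)
          then show ?thesis using True elim by simp
        next
          case False
          then show ?thesis using supp[of y] by auto
        qed
      qed
    qed measurable
    also have "\<dots> = \<i> * iexp \<omega> / complex_of_real (2 * \<omega>) * fourier h (\<tau> * \<omega>)"
      unfolding fourier_def by (rule integral_mult_right_zero)
    finally show ?thesis .
  qed
  show "wave_field f 1 \<omega> = \<i> * iexp \<omega> / complex_of_real (2 * \<omega>) * fourier h \<omega>"
    using general[of 1] by simp
  show "wave_field f (-1) \<omega> = \<i> * iexp \<omega> / complex_of_real (2 * \<omega>) * fourier h (- \<omega>)"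
    using general[of "-1"] by simp
qed

lemma boundary_data_sq_eq_fourier:
  assumes hi: "integrable lborel h" and supp: "\<And>y. 1 < \<bar>y\<bar> \<Longrightarrow> h y = 0"
    and fm: "(\<lambda>y. indicat_real {-1..1} y *\<^sub>R f y) \<in> borel_measurable borel"
    and ae: "AE y in lborel. f y = h y" and K: "0 \<le> K"
  shows "4 * boundary_data_sq f K = (LINT \<xi>:{-K..K}|lborel. (cmod (fourier h \<xi>))\<^sup>2)"
proof -
  have hm: "h \<in> borel_measurable borel" using hi by auto
  define \<phi> where "\<phi> \<xi> = (cmod (fourier h \<xi>))\<^sup>2" for \<xi>
  have cont: "continuous_on UNIV \<phi>"
    unfolding \<phi>_def[abs_def] by (intro continuous_intros fourier_continuous_on hi supp)
  have wave: "wave_field f 1 \<omega> = \<i> * iexp \<omega> / complex_of_real (2 * \<omega>) * fourier h \<omega>"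
    "wave_field f (-1) \<omega> = \<i> * iexp \<omega> / complex_of_real (2 * \<omega>) * fourier h (- \<omega>)" for \<omega>
    by (rule wave_field_eq_fourier[OF hm supp fm ae]; assumption)+
  \<comment> \<open>Division by $\omega = 0$ in the wave field yields $0$.\<close>
  have pt: "\<omega>\<^sup>2 * ((cmod (wave_field f 1 \<omega>))\<^sup>2 + (cmod (wave_field f (-1) \<omega>))\<^sup>2)
      = (if \<omega> = 0 then 0 else 1 / 4 * (\<phi> \<omega> + \<phi> (- \<omega>)))" for \<omega>
    unfolding wave \<phi>_def
    by (simp add: norm_mult norm_divide power_mult_distrib power_divide field_simps)
  have [measurable]: "\<phi> \<in> borel_measurable borel" by (intro borel_measurable_continuous_onI cont)
  have "boundary_data_sq f K = (LINT \<omega>:{0..K}|lborel. 1 / 4 * (\<phi> \<omega> + \<phi> (- \<omega>)))"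
    unfolding boundary_data_sq_def pt set_lebesgue_integral_def
  proof (rule integral_cong_AE)
    have "AE \<omega> in lborel. \<omega> \<noteq> (0::real)" by (rule AE_lborel_singleton)
    then show "AE \<omega> in lborel. indicat_real {0..K} \<omega> *\<^sub>R (if \<omega> = 0 then 0 else 1 / 4 * (\<phi> \<omega> + \<phi> (- \<omega>)))
        = indicat_real {0..K} \<omega> *\<^sub>R (1 / 4 * (\<phi> \<omega> + \<phi> (- \<omega>)))"
      by eventually_elim simp
  qed measurable
  also have "\<dots> = 1 / 4 * (LINT \<omega>:{0..K}|lborel. \<phi> \<omega> + \<phi> (- \<omega>))"
    by (rule set_integral_mult_right)
  also have "(LINT \<omega>:{0..K}|lborel. \<phi> \<omega> + \<phi> (- \<omega>)) = (LINT \<xi>:{-K..K}|lborel. \<phi> \<xi>)"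
    by (rule integral_symmetric_interval[OF cont K, symmetric])
  finally show ?thesis by (simp add: \<phi>_def)
qed

text \<open>Collects what the final argument uses about \<open>f\<close>, with \<open>h\<close> its
  continuous representative; weak derivatives do not occur in the conclusion.\<close>

lemma weak_deriv_fourier_model:
  assumes wd: "weak_deriv f f'" and supp: "compact_supp_in f"
  defines "M \<equiv> max (H1_norm_sq f f') 1"
  obtains h where "integrable lborel h" "\<And>x. 1 < \<bar>x\<bar> \<Longrightarrow> h x = 0" "(LINT x|lborel. cmod (h x)) \<le> 2 * M"
    "\<And>K. 0 \<le> K \<Longrightarrow> 4 * boundary_data_sq f K = (LINT \<xi>:{-K..K}|lborel. (cmod (fourier h \<xi>))\<^sup>2)"
    "\<And>s. 0 < s \<Longrightarrow> L2_norm_sq f \<le> (LINT \<xi>:{-s..s}|lborel. (cmod (fourier h \<xi>))\<^sup>2) + 61 * M\<^sup>2 * s powr (- 4 / 3)"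
proof -
  obtain g where g: "g \<in> borel_measurable borel" "\<And>x. 1 < \<bar>x\<bar> \<Longrightarrow> g x = 0" "integrable lborel (\<lambda>x. (cmod (g x))\<^sup>2)"
    "(LINT x|lborel. (cmod (g x))\<^sup>2) \<le> L2_norm_sq f'" "integrable lborel g" "(LINT x|lborel. g x) = 0"
    "AE x in lborel. f x = (LINT y:{..x}|lborel. g y)"
    by (rule weak_deriv_primitive[OF wd supp]) (rule that; assumption)
  define h where "h x = (LINT y:{..x}|lborel. g y)" for x
  define B where "B = (LINT y|lborel. cmod (g y))"
  define Q where "Q = (LINT y|lborel. (cmod (g y))\<^sup>2)"
  define H where "H = (LINT y|lborel. (cmod (h y))\<^sup>2)"
  have hm [measurable]: "h \<in> borel_measurable borel"
    unfolding h_def[abs_def] by (rule primitive_measurable[OF g(1)])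
  have B: "cmod (h x) \<le> B" for x
    unfolding h_def B_def by (rule primitive_bound[OF g(5)])
  have h0: "h x = 0" if "1 < \<bar>x\<bar>" for x
    unfolding h_def by (rule primitive_eq_0[OF g(2,6) that])
  have mod: "(LINT x|lborel. (cmod (h (x + t) - h x))\<^sup>2) \<le> t\<^sup>2 * Q" for t
    unfolding h_def Q_def by (rule primitive_translation_bound[OF g(5,3)])
  have ae: "AE x in lborel. f x = h x" using g(7) by (simp add: h_def)
  have hi: "integrable lborel h"
    by (rule bounded_support_integrable[where B = B and R = 1]) (use B h0 in auto)
  have h2: "integrable lborel (\<lambda>x. (cmod (h x))\<^sup>2)"
    by (rule bounded_support_integrable[where B = "B\<^sup>2" and R = 1]) (use B h0 in \<open>auto intro!: power_mono\<close>)
  have fm: "(\<lambda>y. indicat_real {-1..1} y *\<^sub>R f y) \<in> borel_measurable borel"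
    using wd by (simp add: weak_deriv_def L2_on_def set_borel_measurable_def)
  have Hf: "L2_norm_sq f = H"
  proof -
    have "(LINT x|lborel. indicat_real {-1..1} x *\<^sub>R (cmod (f x))\<^sup>2) = (LINT x|lborel. (cmod (h x))\<^sup>2)"
    proof (rule integral_cong_AE)
      have "(\<lambda>x. indicat_real {-1..1} x *\<^sub>R (cmod (f x))\<^sup>2) = (\<lambda>x. (cmod (indicat_real {-1..1} x *\<^sub>R f x))\<^sup>2)"
        by (auto simp: indicator_def)
      then show "(\<lambda>x. indicat_real {-1..1} x *\<^sub>R (cmod (f x))\<^sup>2) \<in> borel_measurable lborel"
        using borel_measurable_power[OF measurable_compose[OF fm borel_measurable_norm], of 2]
        by (simp only: measurable_lborel2 measurable_lborel1)
      show "AE x in lborel. indicat_real {-1..1} x *\<^sub>R (cmod (f x))\<^sup>2 = (cmod (h x))\<^sup>2"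
        using ae by eventually_elim (use h0 in \<open>force simp: indicator_def\<close>)
    qed measurable
    then show ?thesis by (simp add: L2_norm_sq_def set_lebesgue_integral_def H_def)
  qed
  have nonneg: "0 \<le> Q" "0 \<le> H" by (simp_all add: Q_def H_def)
  have M: "H + Q \<le> M" "1 \<le> M" using Hf g(4) by (auto simp: M_def H1_norm_sq_def Q_def)
  \<comment> \<open>AM-GM instead of Cauchy--Schwarz loses a factor $\sqrt M$, which the $M^2$ of the estimate absorbs.\<close>
  have A: "(LINT x|lborel. cmod (h x)) \<le> 2 * M"
  proof -
    have "(LINT x|lborel. cmod (h x)) \<le> (LINT x|lborel. (indicat_real {-1..1} x + (cmod (h x))\<^sup>2) / 2)"
    proof (rule integral_mono)
      show "cmod (h x) \<le> (indicat_real {-1..1} x + (cmod (h x))\<^sup>2) / 2" for x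
      proof (cases "1 < \<bar>x\<bar>")
        case False
        have "2 * cmod (h x) \<le> 1 + (cmod (h x))\<^sup>2"
          using zero_le_power2[of "cmod (h x) - 1"] by (simp add: power2_diff)
        then show ?thesis using False by (auto simp: indicator_def abs_le_iff)
      qed (simp add: h0)
    qed (use hi h2 in auto)
    also have "\<dots> = (2 + H) / 2" using h2 by (simp add: H_def)
    finally show ?thesis using M nonneg by simp
  qed
  have "L2_norm_sq f \<le> (LINT \<xi>:{-s..s}|lborel. (cmod (fourier h \<xi>))\<^sup>2) + 61 * M\<^sup>2 * s powr (- 4 / 3)" if s: "0 < s" for s
  proof -
    define J where "J = (LINT \<xi>:{-s..s}|lborel. (cmod (fourier h \<xi>))\<^sup>2)"
    have J0: "0 \<le> J" unfolding J_def set_lebesgue_integral_def by (rule integral_nonneg_AE) auto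
    have pi1: "1 \<le> 2 * pi" using pi_gt3 by linarith
    have "H \<le> J / (2 * pi) + (15 * (2 * M)\<^sup>2 / sqrt (2 * pi) + Q / 2) * s powr (- 4 / 3)"
      unfolding H_def J_def by (rule L2_norm_le_low_frequencies[OF hm B h0 mod A s])
    \<comment> \<open>Denominators are at least 1 and may be dropped. The constant 61 is 15 * 2^2
      from A = 2M, plus 1 for Q/2 \<le> M^2.\<close>
    also have "\<dots> \<le> J / 1 + (15 * (2 * M)\<^sup>2 / 1 + M\<^sup>2) * s powr (- 4 / 3)"
    proof (intro add_mono mult_right_mono divide_left_mono)
      have "M * 1 \<le> M * M" using M(2) by (intro mult_left_mono) auto
      then show "Q / 2 \<le> M\<^sup>2" using M(1) nonneg by (simp add: power2_eq_square)
      show "1 \<le> sqrt (2 * pi)" using pi1 by simp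
    qed (use J0 pi1 in auto)
    also have "\<dots> = J + 61 * M\<^sup>2 * s powr (- 4 / 3)" by (simp add: power_mult_distrib)
    finally show ?thesis by (simp add: Hf J_def)
  qed
  then show ?thesis
    using that[OF hi h0 A boundary_data_sq_eq_fourier[OF hi h0 fm ae]] by blast
qed

theorem theorem1p1:
  shows "\<exists>C>0. \<forall>(f::real \<Rightarrow> complex) (f'::real \<Rightarrow> complex) (K::real) (\<epsilon>::real).
     weak_deriv f f' \<and> compact_supp_in f \<and> K > 1 \<and>
     \<epsilon> = sqrt (boundary_data_sq f K) \<and> 0 < \<epsilon> \<and> \<epsilon> < 1 \<longrightarrow>
     (let E = - ln \<epsilon>; M = max (H1_norm_sq f f') 1 in
      L2_norm_sq f \<le> C * (\<epsilon>\<^sup>2 + M\<^sup>2 / (K powr (2/3) * E powr (1/4) + 1)))"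
proof -
  obtain s0 :: real where s0: "\<And>s. s0 \<le> s \<Longrightarrow>
      \<exists>N>0. (4 * exp 1 * s) ^ N * (4 * exp (- (2 / 3) * s powr (8 / 3)) + 2 * s / fact N) \<le> 1 / s\<^sup>2"
    using extrapolation_factor_eventually unfolding eventually_at_top_linorder by blast
  define s1 where "s1 = max s0 1"
  \<comment> \<open>138 = 2 * (61 + 8): the tail constant and the extrapolation constant 2 * 2^2,
    doubled because s^(-4/3) \<le> 2/D. The other summand covers bounded s, where the extrapolation
    factor need not be small.\<close>
  define C where "C = 138 + 2 * s1 powr (4 / 3)"
  have C: "138 \<le> C" "2 * s1 powr (4 / 3) \<le> C" by (auto simp: C_def)
  have main: "L2_norm_sq f \<le> C * (\<epsilon>\<^sup>2 + M\<^sup>2 / (K powr (2/3) * E powr (1/4) + 1))"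
    if wd: "weak_deriv f f'" and supp: "compact_supp_in f" and K: "1 < K"
      and \<epsilon>: "\<epsilon> = sqrt (boundary_data_sq f K)" "0 < \<epsilon>" "\<epsilon> < 1"
      and E_def: "E = - ln \<epsilon>" and M_def: "M = max (H1_norm_sq f f') 1"
    for f f' K \<epsilon> E M
  proof -
    obtain h where h: "integrable lborel h" "\<And>x. 1 < \<bar>x\<bar> \<Longrightarrow> h x = 0" "(LINT x|lborel. cmod (h x)) \<le> 2 * M"
      "\<And>K. 0 \<le> K \<Longrightarrow> 4 * boundary_data_sq f K = (LINT \<xi>:{-K..K}|lborel. (cmod (fourier h \<xi>))\<^sup>2)"
      "\<And>s. 0 < s \<Longrightarrow> L2_norm_sq f \<le> (LINT \<xi>:{-s..s}|lborel. (cmod (fourier h \<xi>))\<^sup>2) + 61 * M\<^sup>2 * s powr (- 4 / 3)"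
      by (rule weak_deriv_fourier_model[OF wd supp, folded M_def]) (rule that; assumption)
    define J where "J r = (LINT \<xi>:{-r..r}|lborel. (cmod (fourier h \<xi>))\<^sup>2)" for r
    define D where "D = K powr (2/3) * E powr (1/4) + 1"
    define s where "s = max K (E powr (3/8))"
    have E: "0 < E" "\<epsilon>\<^sup>2 = exp (- 2 * E)"
    proof -
      show "0 < E" using \<epsilon>(2,3) by (simp add: E_def)
      have "\<epsilon> = exp (- E)" using \<epsilon>(2) by (simp add: E_def)
      then show "\<epsilon>\<^sup>2 = exp (- 2 * E)" using exp_double[of "- E"] by simp
    qed
    have M: "1 \<le> M" "M \<le> M\<^sup>2" "L2_norm_sq f \<le> M"
    proof -
      show "1 \<le> M" by (simp add: M_def)
      then show "M \<le> M\<^sup>2" using mult_left_mono[of 1 M M] by (simp add: power2_eq_square)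
      have "0 \<le> L2_norm_sq f'"
        unfolding L2_norm_sq_def set_lebesgue_integral_def by (rule integral_nonneg_AE) auto
      then show "L2_norm_sq f \<le> M" by (simp add: M_def H1_norm_sq_def)
    qed
    have JK: "J K = 4 * \<epsilon>\<^sup>2"
    proof -
      \<comment> \<open>\<open>sqrt\<close> is an odd function on the reals, so positivity of
        \<epsilon> passes to its argument, and \<epsilon>^2 is indeed the data integral.\<close>
      have "0 \<le> boundary_data_sq f K" using \<epsilon>(1,2) by simp
      then show ?thesis using h(4)[of K] K by (simp add: J_def \<epsilon>(1))
    qed
    have s: "1 < s" "K \<le> s" using K by (auto simp: s_def)
    have D0: "1 \<le> D" by (simp add: D_def)
    \<comment> \<open>K and E^(3/8) each contribute s^(2/3); the summand 1 is absorbed by the factor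
      2 because s > 1.\<close>
    have D: "D \<le> 2 * s powr (4 / 3)"
    proof -
      have "K powr (2/3) * E powr (1/4) \<le> s powr (2/3) * s powr (2/3)"
      proof (rule mult_mono)
        show "K powr (2/3) \<le> s powr (2/3)" using s K by (intro powr_mono2) auto
        have "E powr (1/4) = (E powr (3/8)) powr (2/3)" by (simp add: powr_powr)
        also have "\<dots> \<le> s powr (2/3)" by (intro powr_mono2) (auto simp: s_def)
        finally show "E powr (1/4) \<le> s powr (2/3)" .
      qed auto
      also have "\<dots> = s powr (4 / 3)" by (simp add: powr_add[symmetric])
      finally show ?thesis using ge_one_powr_ge_zero[of s "4 / 3"] s(1) by (simp add: D_def)
    qed
    have tail: "s powr (- 4 / 3) \<le> 2 / D"
    proof -
      have "s powr (- 4 / 3) = 1 / s powr (4 / 3)" using powr_minus_divide[of s "4 / 3"] by simp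
      also have "\<dots> = 2 / (2 * s powr (4 / 3))" by simp
      also have "\<dots> \<le> 2 / D" using D D0 s(1) by (intro divide_left_mono mult_pos_pos) auto
      finally show ?thesis .
    qed
    have freq: "L2_norm_sq f \<le> J s + 61 * M\<^sup>2 * s powr (- 4 / 3)"
      unfolding J_def using h(5)[of s] s(1) by simp
    \<comment> \<open>Three regimes: s = K, where J s is the data; s = E^(3/8) beyond the threshold
      \<open>s1\<close>, where extrapolation works; and s below \<open>s1\<close>, where the a
      priori bound suffices.\<close>
    have "L2_norm_sq f \<le> C * \<epsilon>\<^sup>2 + C * (M\<^sup>2 / D)"
    proof (cases "s = K \<or> s1 \<le> s")
      case True
      have "J s \<le> 4 * \<epsilon>\<^sup>2 + 8 * M\<^sup>2 * s powr (- 4 / 3)"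
      proof (cases "s = K")
        case False
        then have sE: "s = E powr (3/8)" and "s0 \<le> s" using True by (auto simp: s_def s1_def max_def split: if_splits)
        obtain N where N: "0 < N" "(4 * exp 1 * s) ^ N * (4 * exp (- (2 / 3) * s powr (8 / 3)) + 2 * s / fact N) \<le> 1 / s\<^sup>2"
          using s0[OF \<open>s0 \<le> s\<close>] by blast
        \<comment> \<open>Thus 4 \<epsilon>^2 = 4 exp(-2 s^(8/3)) bounds the integral over [-K,K],
          which contains [0,1] because K > 1.\<close>
        have "s powr (8 / 3) = E" using E(1) by (simp add: sE powr_powr)
        then have small: "(LINT \<xi>:{0..1}|lborel. (cmod (fourier h \<xi>))\<^sup>2) \<le> 4 * exp (- 2 * s powr (8 / 3))"
        proof -
          have "set_integrable lborel {a..b} (\<lambda>\<xi>. (cmod (fourier h \<xi>))\<^sup>2)" for a b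
            by (intro borel_integrable_atLeastAtMost' continuous_intros fourier_continuous_on h)
          then have "(LINT \<xi>:{0..1}|lborel. (cmod (fourier h \<xi>))\<^sup>2) \<le> J K"
            unfolding J_def set_lebesgue_integral_def set_integrable_def using K
            by (intro integral_mono) (auto simp: indicator_def)
          then show ?thesis using JK E(2) \<open>s powr (8 / 3) = E\<close> by simp
        qed
        have "J s \<le> 2 * (2 * M)\<^sup>2 * s powr (- 4 / 3)"
          unfolding J_def
          by (rule fourier_low_frequency_bound[OF h(1,2,3) _ _ small N]) (use M(1) s(1) in auto)
        then show ?thesis by (simp add: power_mult_distrib add_increasing)
      qed (simp add: JK)
      then have "L2_norm_sq f \<le> 4 * \<epsilon>\<^sup>2 + 69 * M\<^sup>2 * s powr (- 4 / 3)"
        using freq by simp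
      also have "\<dots> \<le> 4 * \<epsilon>\<^sup>2 + 69 * M\<^sup>2 * (2 / D)"
        using tail by (intro add_left_mono mult_left_mono) auto
      also have "\<dots> = 4 * \<epsilon>\<^sup>2 + 138 * (M\<^sup>2 / D)" by simp
      also have "\<dots> \<le> C * \<epsilon>\<^sup>2 + C * (M\<^sup>2 / D)"
        using C D0 by (intro add_mono mult_right_mono) auto
      finally show ?thesis .
    next
      case False
      \<comment> \<open>Here D is bounded by C, so the trivial estimate of the squared norm by M
        \<le> M^2 is already at most C M^2/D.\<close>
      have "D \<le> 2 * s1 powr (4 / 3)"
      proof -
        have "s powr (4 / 3) \<le> s1 powr (4 / 3)" using False s(1) by (intro powr_mono2) auto
        then show ?thesis using D by linarith
      qed
      then have "D \<le> C" using C by linarith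
      then have "M\<^sup>2 * 1 \<le> M\<^sup>2 * (C / D)" using D0 by (intro mult_left_mono) auto
      then have "L2_norm_sq f \<le> C * (M\<^sup>2 / D)" using M by (simp add: mult.commute)
      moreover have "0 \<le> C * \<epsilon>\<^sup>2" using C by simp
      ultimately show ?thesis by linarith
    qed
    then show ?thesis by (simp add: D_def distrib_left)
  qed
  show ?thesis
    unfolding Let_def using main C(1) by (intro exI[of _ C]) auto
qed

end
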